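(* Let $$r_1 := \frac{48 + \sqrt{10}}{31} = 1.65039 \cdots, \qquad r_2 := \frac{415\sqrt{149} - 2693}{1438} = 1.65001\cdots .$$ If a Sturmian word $x$ satisfies $r_2 \leq \mathrm{rep}(x) \leq r_1$, then the continued fraction expansion of the slope of $x$ is of the form $$[0,a_1,a_2, \cdots, a_K, (2,1,1)^{n_1}, 1, (2,1,1)^{n_2}, 1, \cdots ]$$ for some $K$ and some infinite sequence $n_1, n_2, \cdots$ of integers greater than $1$, where $(2,1,1)^{n_i}$ denotes the block $2,1,1$ repeated $n_i$ times.
   Context: Words are over the alphabet $\{0,1\}$. For an infinite word $x = x_1x_2\cdots$ write $x_i^{j} = x_i x_{i+1}\cdots x_j$. An infinite word $x$ is Sturmian if for every $n\ge 1$ it has exactly $n+1$ distinct factors (blocks of consecutive letters) of length $n$. For $n \ge 1$, $$r(n,x) = \min\{ m \geq 1 \mid x_{i}^{i+n-1} = x_{m-n+1}^{m} \text{ for some } i \text{ with } 1 \leq i \leq m-n\},$$ and $\mathrm{rep}(x) = \liminf_{n\to\infty} r(n,x)/n$. The slope of a Sturmian word $x$ is the irrational number $\theta\in(0,1)$ equal to the limiting frequency of the digit $1$: $\theta = \lim_{n\to\infty} \#\{1 \le i\le n : x_i = 1\}/n$. $[a_0,a_1,a_2,\dots]$ denotes the simple continued fraction $a_0+1/(a_1+1/(a_2+\cdots))$ with $a_0 \in\mathbb{Z}$ and $a_i$ positive integers for $i\ge1$. *)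

theory Defs
  imports Complex_Main "HOL-Library.Extended_Real" "HOL-Library.Stream"
begin

text \<open>
  Infinite words are functions \<open>x :: nat \<Rightarrow> nat\<close> read as \<open>x 1, x 2, \<dots>\<close>; the value \<open>x 0\<close>
  is never inspected.
\<close>

definition block :: "(nat \<Rightarrow> nat) \<Rightarrow> nat \<Rightarrow> nat \<Rightarrow> nat list" where
  "block x i j = map x [i..<Suc j]"

text \<open>A set of positive cardinality is finite, so \<open>card\<close> is harmless below.\<close>

definition sturmian :: "(nat \<Rightarrow> nat) \<Rightarrow> bool" where
  "sturmian x \<longleftrightarrow>
     (\<forall>i\<ge>1. x i \<in> {0, 1}) \<and>
     (\<forall>n\<ge>1. card {block x i (i + n - 1) | i. i \<ge> 1} = n + 1)"

text \<open>
  Truncated subtraction is harmless: \<open>1 \<le> i \<le> m - n\<close> forces \<open>n < m\<close>. Only \<open>n \<ge> 1\<close> is meaningful.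
\<close>

definition rep_fun :: "nat \<Rightarrow> (nat \<Rightarrow> nat) \<Rightarrow> nat" where
  "rep_fun n x = (LEAST m. m \<ge> 1 \<and>
     (\<exists>i. 1 \<le> i \<and> i \<le> m - n \<and> block x i (i + n - 1) = block x (m - n + 1) m))"

definition rep :: "(nat \<Rightarrow> nat) \<Rightarrow> ereal" where
  "rep x = liminf (\<lambda>n. ereal (real (rep_fun n x) / real n))"

definition slope :: "(nat \<Rightarrow> nat) \<Rightarrow> real" where
  "slope x = lim (\<lambda>n. real (card {i \<in> {1..n}. x i = 1}) / real n)"

text \<open>The finite continued fraction \<open>[c\<^sub>0, \<dots>, c\<^sub>n]\<close>.\<close>

fun convergent_cf :: "int stream \<Rightarrow> nat \<Rightarrow> real" where
  "convergent_cf c 0 = of_int (shd c)"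
| "convergent_cf c (Suc n) = of_int (shd c) + 1 / convergent_cf (stl c) n"

definition has_cf_expansion :: "real \<Rightarrow> int stream \<Rightarrow> bool" where
  "has_cf_expansion \<theta> c \<longleftrightarrow> (\<forall>i\<ge>1. c !! i > 0) \<and> convergent_cf c \<longlonglongrightarrow> \<theta>"

definition cf_block :: "nat \<Rightarrow> int list" where
  "cf_block n = concat (replicate n [2, 1, 1]) @ [1]"

end

theory Submission imports Defs begin

text \<open>
  A Sturmian word is balanced, hence codes a rotation by its slope \<open>\<theta>\<close>. Let \<open>q\<^sub>k\<close> be the denominators of
  the convergents of \<open>\<theta>\<close>. The period \<open>q\<^sub>k\<close> of the word is interrupted exactly at the visits of the rotation
  to an arc next to \<open>0\<close>, and the successive gaps between visits are \<open>q\<^sub>k\<^sub>+\<^sub>1\<close> or \<open>q\<^sub>k + q\<^sub>k\<^sub>+\<^sub>1\<close>. So the first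
  visiting time \<open>i\<^sub>k\<close> yields upper bounds for \<open>r(n, x)\<close>.

  If \<open>rep x > 1.65\<close>, these bounds force \<open>i\<^sub>k\<^sub>+\<^sub>1 = i\<^sub>k + q\<^sub>k\<close> for all large \<open>k\<close> and become linear inequalities
  between \<open>i\<^sub>k, q\<^sub>k, q\<^sub>k\<^sub>+\<^sub>1\<close>, which rule out partial quotients above \<open>2\<close> and the blocks \<open>22\<close>, \<open>212\<close>, \<open>1111\<close> and
  \<open>1112111\<close>. What remains are the expansions in the theorem and those ending in the period \<open>2, 1, 1\<close>. For
  the latter every repetition is compared with a convergent or an intermediate fraction, which gives
  \<open>rep x \<ge> 1.6504 > r\<^sub>1\<close>.
\<close>

section \<open>Sturmian words are balanced\<close>

text \<open>An orbit through an end point of the coding arcs has two codings, so interruptions are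
  read off not from real positions but from weights, the numbers of ones in windows: a period
  \<open>e\<close> lasts as long as the windows of length \<open>e\<close> keep their weight. At a
  convergent this weight takes only two values, and additivity turns the gap structure into integer
  identities. Positions enter only through best approximation.

  An upper bound for r(n, x) needs a single window, but a lower bound must face every period. Where
  a period \<open>e\<close> persists, so does a convergent or intermediate fraction on the same side
  of \<theta> with denominator at most \<open>e\<close>, as long as the partial quotients are at
  most 2.

  The relation between consecutive first visits makes every quantity a few levels up an integer
  combination of those at level \<open>k\<close>, so a forbidden block is an infeasible linear
  system in three unknowns.\<close>

definition fac :: "(nat \<Rightarrow> 'a) \<Rightarrow> nat \<Rightarrow> nat \<Rightarrow> 'a list" where
  "fac x t n = map (\<lambda>j. x (t + 1 + j)) [0..<n]"

lemma length_fac [simp]: "length (fac x t n) = n"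
  by (simp add: fac_def)

lemma fac_eq_iff: "fac x t n = fac x u n \<longleftrightarrow> (\<forall>j<n. x (t + 1 + j) = x (u + 1 + j))"
  by (auto simp: fac_def)

lemma fac_Suc: "fac x t (Suc n) = fac x t n @ [x (t + 1 + n)]"
  by (simp add: fac_def)

lemma fac_Cons: "fac x t (Suc n) = x (t + 1) # fac x (Suc t) n"
  by (rule nth_equalityI) (auto simp: fac_def nth_Cons simp del: upt_Suc split: nat.splits)

lemma take_fac: "m \<le> n \<Longrightarrow> take m (fac x t n) = fac x t m"
  by (simp add: fac_def take_map)

lemma fac_step:
  assumes "fac x t n = fac x u n" "x (t + 1 + n) = x (u + 1 + n)"
  shows "fac x (Suc t) n = fac x (Suc u) n"
proof -
  have "fac x t (Suc n) = fac x u (Suc n)" using assms by (simp add: fac_Suc)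
  then show ?thesis by (simp add: fac_Cons)
qed

lemma block_eq_fac: "i \<ge> 1 \<Longrightarrow> n \<ge> 1 \<Longrightarrow> block x i (i + n - 1) = fac x (i - 1) n"
  by (rule nth_equalityI) (auto simp: block_def fac_def simp del: upt_Suc)

lemma sturmian_letter: "sturmian x \<Longrightarrow> i \<ge> 1 \<Longrightarrow> x i = 0 \<or> x i = 1"
  unfolding sturmian_def by blast

lemma sturmian_card_fac:
  assumes "sturmian x"
  shows "card (range (\<lambda>t. fac x t n)) = n + 1"
proof (cases "n = 0")
  case True
  then have "range (\<lambda>t. fac x t n) = {[]}" by (auto simp: fac_def)
  then show ?thesis using True by simp
next
  case False
  have "{block x i (i + n - 1) | i. i \<ge> 1} = range (\<lambda>t. fac x t n)" (is "?B = _")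
  proof (intro equalityI subsetI)
    fix w assume "w \<in> ?B"
    then obtain i where i: "i \<ge> 1" "w = block x i (i + n - 1)" by blast
    have "w = fac x (i - 1) n" using i False block_eq_fac[of i n x] by simp
    then show "w \<in> range (\<lambda>t. fac x t n)" by blast
  next
    fix w assume "w \<in> range (\<lambda>t. fac x t n)"
    then obtain t where "w = fac x t n" by blast
    then have "w = block x (t + 1) (t + 1 + n - 1)" using False block_eq_fac[of "t + 1" n x] by simp
    moreover have "t + 1 \<ge> 1" by simp
    ultimately show "w \<in> ?B" by blast
  qed
  moreover have "n \<ge> 1" using False by simp
  ultimately show ?thesis using assms unfolding sturmian_def by (metis (no_types, lifting))
qed

lemma sturmian_finite_fac: "sturmian x \<Longrightarrow> finite (range (\<lambda>t. fac x t n))"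
  by (rule card_ge_0_finite) (simp add: sturmian_card_fac)

text \<open>With preperiod \<open>s\<close> and period \<open>P\<close>, every factor of length
  \<open>n = s + P\<close> already starts before time \<open>n\<close>, which leaves at most
  \<open>n\<close> of them.\<close>

lemma sturmian_not_eventually_periodic:
  assumes "sturmian x" "P \<ge> 1" "\<And>j. j \<ge> s \<Longrightarrow> x (j + P) = x j"
  shows False
proof -
  define n where "n = s + P"
  have per: "fac x (t + P) n = fac x t n" if "t \<ge> s" for t
  proof -
    have "x (t + P + 1 + j) = x (t + 1 + j)" for j
      using assms(3)[of "t + 1 + j"] that by (simp add: algebra_simps)
    then show ?thesis by (simp add: fac_eq_iff)
  qed
  have "\<exists>u<n. fac x t n = fac x u n" for t
  proof (induction t rule: less_induct)
    case (less t)
    show ?case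
    proof (cases "t < n")
      case False
      then have "fac x t n = fac x (t - P) n" using per[of "t - P"] by (simp add: n_def)
      moreover have "t - P < t" using False assms(2) by (simp add: n_def)
      ultimately show ?thesis using less.IH[of "t - P"] by simp
    qed blast
  qed
  then have "range (\<lambda>t. fac x t n) \<subseteq> (\<lambda>t. fac x t n) ` {..<n}" by blast
  then have "card (range (\<lambda>t. fac x t n)) \<le> n"
    by (metis card_image_le card_lessThan card_mono finite_imageI finite_lessThan order_trans)
  then show False using sturmian_card_fac[OF assms(1), of n] by simp
qed

section \<open>Branching vertices of the Rauzy graph\<close>

definition right_special :: "(nat \<Rightarrow> 'a) \<Rightarrow> nat \<Rightarrow> nat \<Rightarrow> bool" where
  "right_special x t n \<longleftrightarrow> (\<exists>u v. fac x u n = fac x t n \<and> fac x v n = fac x t n \<and>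
     x (u + 1 + n) \<noteq> x (v + 1 + n))"

text \<open>If two factors of length \<open>n\<close> branched, dropping one extension of each would
  still leave an extension of every factor of length \<open>n\<close>, so \<open>n\<close> words
  would have to cover \<open>n + 1\<close>.\<close>

lemma right_special_unique:
  assumes "sturmian x" "right_special x t n" "right_special x u n"
  shows "fac x t n = fac x u n"
proof (rule ccontr)
  assume ne: "fac x t n \<noteq> fac x u n"
  let ?F = "\<lambda>m. range (\<lambda>t. fac x t m)"
  obtain t1 t2 where t: "fac x t1 n = fac x t n" "fac x t2 n = fac x t n"
    "x (t1 + 1 + n) \<noteq> x (t2 + 1 + n)" using assms(2) unfolding right_special_def by blast
  obtain u1 u2 where u: "fac x u1 n = fac x u n" "fac x u2 n = fac x u n"
    "x (u1 + 1 + n) \<noteq> x (u2 + 1 + n)" using assms(3) unfolding right_special_def by blast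
  define A where "A = ?F (Suc n) - {fac x t2 (Suc n), fac x u2 (Suc n)}"
  have "fac x t2 (Suc n) \<noteq> fac x u2 (Suc n)" using ne t u by (simp add: fac_Suc)
  then have "card A = n"
    unfolding A_def using sturmian_finite_fac[OF assms(1), of "Suc n"] sturmian_card_fac[OF assms(1), of "Suc n"]
    by (subst card_Diff_subset) auto
  moreover have "?F n \<subseteq> take n ` A"
  proof
    fix w assume "w \<in> ?F n"
    then obtain s where s: "w = fac x s n" by blast
    consider "fac x s (Suc n) = fac x t2 (Suc n)" | "fac x s (Suc n) = fac x u2 (Suc n)"
      | "fac x s (Suc n) \<in> A" unfolding A_def by blast
    then have "\<exists>r. fac x r (Suc n) \<in> A \<and> fac x r n = w"
    proof cases
      case 1
      then have "fac x t1 n = w" using s t by (simp add: fac_Suc)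
      moreover have "fac x t1 (Suc n) \<noteq> fac x t2 (Suc n)" "fac x t1 (Suc n) \<noteq> fac x u2 (Suc n)"
        using t u ne by (auto simp: fac_Suc)
      then have "fac x t1 (Suc n) \<in> A" unfolding A_def by blast
      ultimately show ?thesis by blast
    next
      case 2
      then have "fac x u1 n = w" using s u by (simp add: fac_Suc)
      moreover have "fac x u1 (Suc n) \<noteq> fac x t2 (Suc n)" "fac x u1 (Suc n) \<noteq> fac x u2 (Suc n)"
        using t u ne by (auto simp: fac_Suc)
      then have "fac x u1 (Suc n) \<in> A" unfolding A_def by blast
      ultimately show ?thesis by blast
    next
      case 3
      then show ?thesis using s by blast
    qed
    then obtain r where "fac x r (Suc n) \<in> A" "fac x r n = w" by blast
    then show "w \<in> take n ` A" using take_fac[of n "Suc n" x r] by (metis image_eqI le_SucI order_refl)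
  qed
  moreover have "finite A" unfolding A_def using sturmian_finite_fac[OF assms(1)] by blast
  ultimately have "card (?F n) \<le> n" by (metis card_image_le card_mono finite_imageI order_trans)
  then show False using sturmian_card_fac[OF assms(1), of n] by simp
qed

text \<open>A window on which the walk through the Rauzy graph meets no branching vertex and
  which has more positions than there are non-branching vertices runs into a cycle.\<close>

lemma sturmian_meets_right_special:
  assumes "sturmian x" "right_special x v n"
  shows "\<exists>s. t \<le> s \<and> s \<le> t + n \<and> fac x s n = fac x v n"
proof (rule ccontr)
  assume "\<not> ?thesis"
  then have no: "fac x s n \<noteq> fac x v n" if "t \<le> s" "s \<le> t + n" for s using that by blast
  let ?F = "range (\<lambda>t. fac x t n)"
  have "(\<lambda>s. fac x s n) ` {t..t + n} \<subseteq> ?F - {fac x v n}" using no by auto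
  then have "card ((\<lambda>s. fac x s n) ` {t..t + n}) \<le> card (?F - {fac x v n})"
    by (intro card_mono) (auto simp: sturmian_finite_fac[OF assms(1)])
  also have "\<dots> = n" using sturmian_card_fac[OF assms(1), of n] sturmian_finite_fac[OF assms(1)]
    by (subst card_Diff_singleton) auto
  finally have "\<not> inj_on (\<lambda>s. fac x s n) {t..t + n}" using card_image[of "\<lambda>s. fac x s n" "{t..t + n}"] by auto
  then obtain r r' where "r \<in> {t..t+n}" "r' \<in> {t..t+n}" "r \<noteq> r'" "fac x r n = fac x r' n"
    unfolding inj_on_def by blast
  then obtain s P where sP: "t \<le> s" "P \<ge> 1" "s + P \<le> t + n" "fac x (s + P) n = fac x s n"
  proof (induction r r' rule: linorder_wlog)
    case (le a b)
    then show ?case by (auto intro: le(2)[of a "b - a"])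
  next
    case (sym a b)
    then show ?case by metis
  qed
  have ext: "x (c + 1 + n) = x (d + 1 + n)" if "fac x c n = fac x d n" "t \<le> c" "c \<le> t + n" for c d
  proof (rule ccontr)
    assume "x (c + 1 + n) \<noteq> x (d + 1 + n)"
    then have "right_special x c n" unfolding right_special_def using that(1) by (intro exI[of _ c] exI[of _ d]) auto
    then show False using right_special_unique[OF assms(1) _ assms(2)] no that by blast
  qed
  have rep: "fac x (s + j) n = fac x (s + j mod P) n" for j
  proof (induction j)
    case (Suc j)
    have "j mod P < P" using sP(2) by simp
    then have "x (s + j mod P + 1 + n) = x (s + j + 1 + n)"
      using Suc.IH sP(1,3) by (intro ext) (simp, linarith+)
    then have 1: "fac x (s + Suc j) n = fac x (s + Suc (j mod P)) n"
      using fac_step[OF Suc.IH] by simp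
    show ?case
    proof (cases "Suc (j mod P) = P")
      case True
      then have "Suc j mod P = 0" by (simp add: mod_Suc)
      then show ?thesis using 1 True sP(4) by simp
    next
      case False
      then have "Suc j mod P = Suc (j mod P)" by (simp add: mod_Suc)
      then show ?thesis using 1 by simp
    qed
  qed simp
  have "x (j + P) = x j" if "j \<ge> s + n + 1" for j
  proof -
    define i where "i = j - (s + n + 1)"
    have j: "j = s + i + 1 + n" using that by (simp add: i_def)
    have lt: "i mod P < P" using sP(2) by simp
    have "x (s + i mod P + 1 + n) = x (s + k + 1 + n)" if "k mod P = i mod P" for k
      using rep[of k] lt sP(1,3) that by (intro ext) (simp, linarith+)
    from this[of i] this[of "i + P"] have "x (s + i + 1 + n) = x (s + (i + P) + 1 + n)" by simp
    moreover have "j + P = s + (i + P) + 1 + n" using j by simp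
    ultimately show ?thesis using j by metis
  qed
  then show False using sturmian_not_eventually_periodic[OF assms(1) sP(2)] by blast
qed

section \<open>Weights of windows and balance\<close>

definition weight :: "(nat \<Rightarrow> nat) \<Rightarrow> nat \<Rightarrow> nat \<Rightarrow> int" where
  "weight x t d = (\<Sum>j<d. int (x (t + 1 + j)))"

lemma weight_0 [simp]: "weight x t 0 = 0"
  by (simp add: weight_def)

lemma weight_Suc: "weight x t (Suc d) = weight x t d + int (x (t + 1 + d))"
  by (simp add: weight_def)

lemma weight_add: "weight x t (d + e) = weight x t d + weight x (t + d) e"
  by (induction e) (simp_all add: weight_Suc add.assoc add.commute add.left_commute)

lemma weight_Suc_left: "weight x t (Suc d) = int (x (t + 1)) + weight x (Suc t) d"
  using weight_add[of x t 1 d] by (simp add: weight_Suc)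

text \<open>A shortest pair of windows whose weights differ by two reads \<open>1 w 1\<close> and
  \<open>0 w 0\<close> with \<open>w\<close> a palindrome. Then \<open>w\<close> is the branching
  factor of its length, and neither letter can precede it in the next longer branching
  factor.\<close>

lemma sturmian_balanced:
  assumes "sturmian x"
  shows "weight x t n - weight x u n \<le> 1"
proof (rule ccontr)
  assume "\<not> ?thesis"
  then have ex: "\<exists>n t u. weight x t n - weight x u n \<ge> 2" by (metis linorder_not_le zle_add1_eq_le one_add_one add.commute)
  define n where "n = (LEAST n. \<exists>t u. weight x t n - weight x u n \<ge> 2)"
  have "\<exists>t u. weight x t n - weight x u n \<ge> 2" unfolding n_def using LeastI_ex[OF ex] .
  then obtain t u where tu: "weight x t n - weight x u n \<ge> 2" by blast
  have small: "weight x r m - weight x s m \<le> 1" if "m < n" for r s m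
    using not_less_Least[OF that[unfolded n_def]] by (metis linorder_not_le zle_add1_eq_le one_add_one add.commute)
  \<comment> \<open>By minimality each part of a split differs by at most one, while the total
    differs by at least two; so each part differs by exactly one.\<close>
  have pre: "weight x t m = weight x u m + 1" and suf: "weight x (t + n - m) m = weight x (u + n - m) m + 1"
    if "1 \<le> m" "m < n" for m
  proof -
    have *: "weight x t k = weight x u k + 1 \<and> weight x (t + k) (n - k) = weight x (u + k) (n - k) + 1"
      if "1 \<le> k" "k < n" for k
      using small[of k t u] small[of "n - k" "t + k" "u + k"] weight_add[of x t k "n - k"] weight_add[of x u k "n - k"] tu that
      by (simp add: )
    show "weight x t m = weight x u m + 1" using *[OF that] by simp
    show "weight x (t + n - m) m = weight x (u + n - m) m + 1" using *[of "n - m"] that by simp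
  qed
  have letter: "int (x i) = 0 \<or> int (x i) = 1" if "i \<ge> 1" for i using sturmian_letter[OF assms that] by auto
  have n2: "n \<ge> 2"
  proof (rule ccontr)
    assume "\<not> n \<ge> 2"
    then have "n = 0 \<or> n = 1" by linarith
    then show False using tu letter[of "t + 1"] letter[of "u + 1"] by (auto simp: weight_Suc)
  qed
  then obtain N where N: "n = Suc (Suc N)" using add_2_eq_Suc le_Suc_ex by blast
  have first: "x (t + 1) = 1" "x (u + 1) = 0"
    using pre[of 1] N letter[of "t + 1"] letter[of "u + 1"] by (auto simp: weight_Suc)
  have last: "x (t + n) = 1" "x (u + n) = 0"
    using suf[of 1] N letter[of "t + n"] letter[of "u + n"] by (auto simp: weight_Suc)
  have same: "x (t + 1 + m) = x (u + 1 + m)" if "1 \<le> m" "m \<le> N" for m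
    using pre[of m] pre[of "Suc m"] that N by (simp add: weight_Suc)
  have eq: "weight x (u + n - m) m = weight x u m" if "1 \<le> m" "m < n" for m
    using small[of m t "u + n - m"] small[of m "t + n - m" u] pre[OF that] suf[OF that] that by simp
  have pal: "x (u + 1 + m) = x (u + n - m)" if "1 \<le> m" "m \<le> N" for m
  proof -
    have "u + n - m = Suc (u + n - Suc m)" using that N by simp
    then show ?thesis
      using eq[of m] eq[of "Suc m"] that N weight_Suc_left[of x "u + n - Suc m" m] by (simp add: weight_Suc)
  qed
  have w: "fac x (Suc t) N = fac x (Suc u) N"
    using same[of "Suc _"] by (auto simp: fac_eq_iff)
  text \<open>The common inner word is right special, hence so is its extension to the left by one of the
    two letters; the other extension begins a window which, the inner word being a palindrome,
    misses that branching factor.\<close>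
  have "right_special x (Suc t) N" unfolding right_special_def using w last N
    by (intro exI[of _ "Suc t"] exI[of _ "Suc u"]) auto
  have "\<exists>v. right_special x v (Suc N)"
  proof (rule ccontr)
    assume no: "\<not> ?thesis"
    have "inj_on (take (Suc N)) (range (\<lambda>t. fac x t (Suc (Suc N))))"
    proof (rule inj_onI; clarsimp)
      fix c d assume "take (Suc N) (fac x c (Suc (Suc N))) = take (Suc N) (fac x d (Suc (Suc N)))"
      then have e: "fac x c (Suc N) = fac x d (Suc N)" by (simp only: take_fac le_SucI order_refl)
      have "x (c + 1 + Suc N) = x (d + 1 + Suc N)" using no e unfolding right_special_def by metis
      then show "fac x c (Suc (Suc N)) = fac x d (Suc (Suc N))" using e by (simp only: fac_Suc[of x _ "Suc N"])
    qed
    then have "card (take (Suc N) ` range (\<lambda>t. fac x t (Suc (Suc N)))) = N + 3"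
      using sturmian_card_fac[OF assms, of "Suc (Suc N)"] by (simp add: card_image)
    moreover have "take (Suc N) ` range (\<lambda>t. fac x t (Suc (Suc N))) = range (\<lambda>t. fac x t (Suc N))"
      by (simp only: image_image take_fac le_SucI order_refl)
    ultimately show False using sturmian_card_fac[OF assms, of "Suc N"] by simp
  qed
  then obtain v where v: "right_special x v (Suc N)" by blast
  have "right_special x (Suc v) N"
    using v unfolding right_special_def fac_Cons by (metis add_Suc add_Suc_right list.inject)
  then have vw: "fac x (Suc v) N = fac x (Suc t) N"
    using right_special_unique[OF assms _ \<open>right_special x (Suc t) N\<close>] by blast
  have avoid: False
    if r: "r = t \<or> r = u" and ne: "x (v + 1) \<noteq> x (r + 1)" for r
  proof -
    have rw: "fac x (Suc r) N = fac x (Suc u) N" and rl: "x (r + n) = x (r + 1)" using r w first last by auto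
    obtain s where s: "r \<le> s" "s \<le> r + Suc N" "fac x s (Suc N) = fac x v (Suc N)"
      using sturmian_meets_right_special[OF assms v, of r] by blast
    define j where "j = s - r"
    have sj: "s = r + j" "j \<le> Suc N" using s by (auto simp: j_def)
    have s1: "x (s + 1) = x (v + 1)" and s2: "fac x (Suc s) N = fac x (Suc u) N"
      using s(3) vw w by (simp_all add: fac_Cons)
    have ri: "x (r + 1 + i) = x (u + 1 + i)" if "1 \<le> i" "i \<le> N" for i
      using rw that unfolding fac_eq_iff by (auto dest: spec[of _ "i - 1"])
    have si: "x (s + 1 + i) = x (u + 1 + i)" if "1 \<le> i" "i \<le> N" for i
      using s2 that unfolding fac_eq_iff by (auto dest: spec[of _ "i - 1"])
    consider "j = 0" | "1 \<le> j" "j \<le> N" | "j = Suc N" using sj(2) by linarith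
    then show False
    proof cases
      case 1
      then show ?thesis using s1 ne sj by simp
    next
      case 2
      \<comment> \<open>Letter \<open>N + 1 - j\<close> of the copy of \<open>w\<close> at
        \<open>s\<close> is the last letter of the window at \<open>r\<close>. Reflecting the
        palindrome sends it to letter \<open>j\<close> of the copy at \<open>r\<close>, which is the
        first letter at \<open>s\<close>.\<close>
      have "x (r + 1) = x (s + 1 + (N + 1 - j))" using rl 2 sj N by simp
      also have "\<dots> = x (u + 1 + (N + 1 - j))" using 2 by (intro si) auto
      also have "\<dots> = x (u + 1 + j)" using pal[of j] 2 N by (simp add: Suc_diff_le)
      also have "\<dots> = x (v + 1)" using ri[of j] 2 s1 sj by simp
      finally show ?thesis using ne by simp
    next
      case 3
      then show ?thesis using s1 ne sj rl N by simp
    qed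
  qed
  show False
    using avoid[of t] avoid[of u] first by fastforce
qed

section \<open>The slope\<close>

lemma weight_bounds:
  assumes "sturmian x"
  shows "0 \<le> weight x t n" "weight x t n \<le> int n"
proof -
  have "int (x (t + 1 + j)) \<le> 1" for j using sturmian_letter[OF assms, of "t + 1 + j"] by auto
  then show "weight x t n \<le> int n" unfolding weight_def
    using sum_bounded_above[of "{..<n}" "\<lambda>j. int (x (t + 1 + j))" 1] by simp
  show "0 \<le> weight x t n" unfolding weight_def by (rule sum_nonneg) simp
qed

lemma weight_multiple:
  assumes "\<And>t. a \<le> weight x t n \<and> weight x t n \<le> b"
  shows "int m * a \<le> weight x t (m * n) \<and> weight x t (m * n) \<le> int m * b"
proof (induction m)
  case (Suc m)
  then show ?case using assms[of "t + m * n"] weight_add[of x t "m * n" n]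
    by (simp add: algebra_simps)
qed simp

lemma weight_eq_card:
  assumes "sturmian x"
  shows "weight x 0 n = int (card {i \<in> {1..n}. x i = 1})"
proof (induction n)
  case (Suc n)
  have "{i \<in> {1..Suc n}. x i = 1} = {i \<in> {1..n}. x i = 1} \<union> (if x (Suc n) = 1 then {Suc n} else {})"
    by (auto simp: le_Suc_eq)
  then have "card {i \<in> {1..Suc n}. x i = 1} = card {i \<in> {1..n}. x i = 1} + (if x (Suc n) = 1 then 1 else 0)"
    by (auto simp: card_insert_if)
  then show ?case using Suc sturmian_letter[OF assms, of "Suc n"] by (auto simp: weight_Suc)
qed simp

text \<open>By balance the weight of a window of length \<open>m * n\<close> differs from
  \<open>m\<close> times that of one of length \<open>n\<close> by at most \<open>m\<close>.
  Exchanging \<open>m\<close> and \<open>n\<close> gives the Cauchy estimate, and \<open>m\<close>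
  tending to infinity gives the deviation bound.\<close>

lemma sturmian_frequency:
  assumes "sturmian x"
  shows "(\<lambda>n. weight x 0 n / n) \<longlonglongrightarrow> slope x"
    and "\<bar>weight x t n - n * slope x\<bar> \<le> 1"
proof -
  define f where "f n = real_of_int (weight x 0 n)" for n
  have near: "\<bar>real_of_int (weight x t n) - f n\<bar> \<le> 1" for t n
    using sturmian_balanced[OF assms, of t n 0] sturmian_balanced[OF assms, of 0 n t]
    unfolding f_def by linarith
  have mult: "\<bar>real_of_int (weight x t (m * n)) - m * weight x t n\<bar> \<le> m" for t m n
  proof -
    have "weight x t n - 1 \<le> weight x s n \<and> weight x s n \<le> weight x t n + 1" for s
      using sturmian_balanced[OF assms, of t n s] sturmian_balanced[OF assms, of s n t] by linarith
    from weight_multiple[OF this, of m t]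
    have "\<bar>weight x t (m * n) - int m * weight x t n\<bar> \<le> int m" by (simp add: algebra_simps abs_le_iff)
    then have "\<bar>real_of_int (weight x t (m * n) - int m * weight x t n)\<bar> \<le> real_of_int (int m)"
      by (metis of_int_abs of_int_le_iff)
    then show ?thesis by simp
  qed
  have cau: "\<bar>f n / n - f m / m\<bar> \<le> 1 / n + 1 / m" if "n \<ge> 1" "m \<ge> 1" for n m
  proof -
    have "\<bar>m * f n - n * f m\<bar> \<le> m + n"
      using mult[of 0 m n] mult[of 0 n m] unfolding f_def by (simp add: mult.commute)
    then have "\<bar>m * f n - n * f m\<bar> / (n * m) \<le> (m + n) / (n * m)" by (intro divide_right_mono) auto
    moreover have "f n / n - f m / m = (m * f n - n * f m) / (n * m)" using that by (simp add: field_simps)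
    moreover have "1 / n + 1 / m = (m + n) / (n * m)" using that by (simp add: field_simps)
    ultimately show ?thesis by (simp add: abs_divide)
  qed
  have "Cauchy (\<lambda>n. f n / n)"
  proof (rule metric_CauchyI)
    fix e :: real assume e: "e > 0"
    define N where "N = nat \<lceil>2 / e\<rceil> + 1"
    have "dist (f m / m) (f n / n) < e" if "m \<ge> N" "n \<ge> N" for m n
    proof -
      have "N > 2 / e" unfolding N_def by linarith
      then have *: "1 / k < e / 2" if "k \<ge> N" for k :: nat
      proof -
        have "k > 2 / e" using \<open>N > 2 / e\<close> that by linarith
        moreover have "real k > 0" using that N_def by simp
        ultimately show ?thesis using e by (simp add: field_simps)
      qed
      have "\<bar>f m / m - f n / n\<bar> \<le> 1 / m + 1 / n" using that by (intro cau) (auto simp: N_def)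
      then show ?thesis using *[OF that(1)] *[OF that(2)] by (simp add: dist_real_def)
    qed
    then show "\<exists>M. \<forall>m\<ge>M. \<forall>n\<ge>M. dist (f m / m) (f n / n) < e" by blast
  qed
  then have lim0: "(\<lambda>n. f n / n) \<longlonglongrightarrow> lim (\<lambda>n. f n / n)"
    by (simp add: Cauchy_convergent convergent_LIMSEQ_iff[symmetric])
  have "slope x = lim (\<lambda>n. f n / n)"
    unfolding slope_def f_def weight_eq_card[OF assms] by simp
  then have lim: "(\<lambda>n. f n / n) \<longlonglongrightarrow> slope x" using lim0 by simp
  then show "(\<lambda>n. weight x 0 n / n) \<longlonglongrightarrow> slope x" unfolding f_def .
  show "\<bar>weight x t n - n * slope x\<bar> \<le> 1"
  proof (cases "n = 0")
    case False
    have le: "\<bar>weight x t n / n - f (m * n) / (m * n)\<bar> \<le> 1 / n + inverse (real m)" if "m \<ge> 1" for m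
    proof -
      have "\<bar>f (m * n) - m * weight x t n\<bar> \<le> m + 1"
        using mult[of t m n] near[of t "m * n"] by linarith
      then have "\<bar>f (m * n) - m * weight x t n\<bar> / (m * n) \<le> (m + 1) / (m * n)"
        by (intro divide_right_mono) auto
      also have "\<dots> = 1 / n + inverse m / n" using that False by (simp add: field_simps)
      also have "inverse m / n \<le> inverse (real m)" using that False by (simp add: field_simps)
      also have "\<bar>f (m * n) - m * weight x t n\<bar> / (m * n) = \<bar>weight x t n / n - f (m * n) / (m * n)\<bar>"
      proof -
        have "weight x t n / n - f (m * n) / (m * n) = - ((f (m * n) - m * weight x t n) / (m * n))"
          using that False by (simp add: field_simps)
        then show ?thesis by (simp add: abs_divide)
      qed
      finally show ?thesis by simp
    qed
    have "strict_mono (\<lambda>m. m * n)" using False by (simp add: strict_mono_def)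
    from LIMSEQ_subseq_LIMSEQ[OF lim this]
    have l1: "(\<lambda>m. f (m * n) / (m * n)) \<longlonglongrightarrow> slope x" by (simp add: o_def)
    have "(\<lambda>m. \<bar>weight x t n / n - f (m * n) / (m * n)\<bar>) \<longlonglongrightarrow> \<bar>weight x t n / n - slope x\<bar>"
      by (intro tendsto_intros l1)
    moreover have "(\<lambda>m. 1 / n + inverse (real m)) \<longlonglongrightarrow> 1 / n + 0"
      by (intro tendsto_intros lim_inverse_n)
    ultimately have "\<bar>weight x t n / n - slope x\<bar> \<le> 1 / n + 0"
      by (rule LIMSEQ_le) (use le in blast)
    then have "\<bar>weight x t n / n - slope x\<bar> * n \<le> 1" using False by (simp add: field_simps)
    moreover have "weight x t n - n * slope x = (weight x t n / n - slope x) * n" using False by (simp add: field_simps)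
    ultimately show ?thesis by (simp add: abs_mult)
  qed simp
qed

text \<open>For slope \<open>p / q\<close>, balance gives the deviations
  \<open>weight x t q - p\<close> one common sign. Two nonzero ones at times congruent modulo
  \<open>q\<close> would add up inside a window of length divisible by \<open>q\<close>, where the
  deviation is at most one. So at most \<open>q\<close> times deviate, and \<open>x\<close> is
  eventually periodic.\<close>

lemma sturmian_slope_irrational:
  assumes "sturmian x"
  shows "slope x \<notin> \<rat>"
proof
  assume "slope x \<in> \<rat>"
  then obtain p q where pq: "q > 0" "slope x = of_int p / of_nat q"
    by (rule Rats_cases') (metis of_int_of_nat_eq of_nat_nat order_less_imp_le zero_less_nat_eq)
  have dev: "\<bar>weight x t (m * q) - int m * p\<bar> \<le> 1" for t m
  proof -
    have "\<bar>real_of_int (weight x t (m * q) - int m * p)\<bar> \<le> 1"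
      using sturmian_frequency(2)[OF assms, of t "m * q"] pq by simp
    then show ?thesis by linarith
  qed
  have "\<exists>\<sigma>\<in>{1, -1}. \<forall>t. \<sigma> * (weight x t q - p) \<ge> 0"
  proof (rule ccontr)
    assume *: "\<not> ?thesis"
    then have "\<not> (\<forall>t. 0 \<le> weight x t q - p)" "\<not> (\<forall>t. weight x t q - p \<le> 0)" by auto
    then obtain t u where "weight x t q - p < 0" "weight x u q - p > 0" by (auto simp: not_le)
    then show False using sturmian_balanced[OF assms, of u q t] by linarith
  qed
  then obtain \<sigma> :: int where \<sigma>: "\<sigma> = 1 \<or> \<sigma> = -1" and pos: "\<And>t. \<sigma> * (weight x t q - p) \<ge> 0" by blast
  have pos': "\<sigma> * (weight x t (m * q) - int m * p) \<ge> 0" for t m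
  proof (induction m)
    case (Suc m)
    then show ?case using pos[of "t + m * q"] weight_add[of x t "m * q" q] by (simp add: algebra_simps)
  qed simp
  have "inj_on (\<lambda>t. t mod q) {t. weight x t q \<noteq> p}"
  proof (rule linorder_inj_onI')
    fix t u assume tu: "t \<in> {t. weight x t q \<noteq> p}" "u \<in> {t. weight x t q \<noteq> p}" "t < u"
    show "t mod q \<noteq> u mod q"
    proof
      assume "t mod q = u mod q"
      then have "q dvd u - t" using tu(3) mod_eq_dvd_iff_nat[of t u q] by simp
      then obtain m where "u - t = q * m" by blast
      then have u: "u = t + m * q" using tu(3) by (simp add: mult.commute)
      have "m \<ge> 1" using u tu(3) by (cases m) auto
      then obtain k where k: "m = Suc k" by (cases m) auto
      have ge1: "\<sigma> * (weight x s q - p) \<ge> 1" if "weight x s q \<noteq> p" for s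
        using pos[of s] that \<sigma> by auto
      have "weight x t (Suc m * q) = weight x t q + weight x (t + q) (k * q) + weight x u q"
        using weight_add[of x t "m * q" q] weight_add[of x t q "k * q"] u k by (simp add: algebra_simps)
      then have "\<sigma> * (weight x t (Suc m * q) - int (Suc m) * p) =
          \<sigma> * (weight x t q - p) + \<sigma> * (weight x (t + q) (k * q) - int k * p) + \<sigma> * (weight x u q - p)"
        using k by (simp add: algebra_simps)
      then have "\<sigma> * (weight x t (Suc m * q) - int (Suc m) * p) \<ge> 2"
        using ge1[of t] ge1[of u] pos'[of "t + q" k] tu by simp
      then show False using dev[of t "Suc m"] \<sigma> by auto
    qed
  qed
  moreover have "(\<lambda>t. t mod q) ` {t. weight x t q \<noteq> p} \<subseteq> {..<q}" using pq by auto
  ultimately have "finite {t. weight x t q \<noteq> p}"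
    by (meson finite_imageD finite_lessThan finite_subset)
  then obtain s where s: "\<And>t. t \<ge> s \<Longrightarrow> weight x t q = p"
    using finite_nat_set_iff_bounded_le[of "{t. weight x t q \<noteq> p}"]
    by (metis (mono_tags, lifting) mem_Collect_eq not_less_eq_eq)
  have "x (j + q) = x j" if "j \<ge> s + 1" for j
  proof -
    obtain i where i: "j = Suc i" "i \<ge> s" using \<open>j \<ge> s + 1\<close> by (cases j) auto
    have "weight x i q + int (x (i + 1 + q)) = int (x (i + 1)) + weight x (Suc i) q"
      by (metis weight_Suc weight_Suc_left)
    then show ?thesis using s[of i] s[of "Suc i"] i by simp
  qed
  then show False using sturmian_not_eventually_periodic[OF assms, of q "s + 1"] pq by simp
qed

section \<open>Continued fractions and best approximation\<close>

fun complete_quotient :: "real \<Rightarrow> nat \<Rightarrow> real" where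
  "complete_quotient \<theta> 0 = \<theta>"
| "complete_quotient \<theta> (Suc n) = 1 / frac (complete_quotient \<theta> n)"

definition partial_quotient :: "real \<Rightarrow> nat \<Rightarrow> nat" where
  "partial_quotient \<theta> n = nat \<lfloor>complete_quotient \<theta> n\<rfloor>"

lemma complete_quotient_irrational: "\<theta> \<notin> \<rat> \<Longrightarrow> complete_quotient \<theta> n \<notin> \<rat>"
proof (induction n)
  case (Suc n)
  show ?case
  proof
    assume "complete_quotient \<theta> (Suc n) \<in> \<rat>"
    then have "1 / (1 / frac (complete_quotient \<theta> n)) \<in> \<rat>" by (simp del: divide_divide_eq_right)
    then have "frac (complete_quotient \<theta> n) + of_int \<lfloor>complete_quotient \<theta> n\<rfloor> \<in> \<rat>" by simp
    then show False using Suc by (simp add: frac_def)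
  qed
qed simp

lemma frac_complete_quotient:
  assumes "\<theta> \<notin> \<rat>"
  shows "0 < frac (complete_quotient \<theta> n)" "frac (complete_quotient \<theta> n) < 1"
proof -
  have "complete_quotient \<theta> n \<notin> \<int>" using complete_quotient_irrational[OF assms] Ints_subset_Rats by blast
  then show "0 < frac (complete_quotient \<theta> n)" by (simp add: frac_gt_0_iff)
qed (rule frac_lt_1)

lemma complete_quotient_gt_1: "\<theta> \<notin> \<rat> \<Longrightarrow> n \<ge> 1 \<Longrightarrow> complete_quotient \<theta> n > 1"
  using frac_complete_quotient[of \<theta> "n - 1"] by (cases n) auto

declare complete_quotient.simps(2) [simp del]

lemma partial_quotient_ge_1: "\<theta> \<notin> \<rat> \<Longrightarrow> n \<ge> 1 \<Longrightarrow> partial_quotient \<theta> n \<ge> 1"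
  using complete_quotient_gt_1[of \<theta> n] unfolding partial_quotient_def by linarith

lemma complete_quotient_eq:
  assumes "\<theta> \<notin> \<rat>" "n \<ge> 1"
  shows "complete_quotient \<theta> n = partial_quotient \<theta> n + 1 / complete_quotient \<theta> (Suc n)"
  using complete_quotient_gt_1[OF assms] by (simp add: partial_quotient_def frac_def complete_quotient.simps(2))

text \<open>The seeds belong to an expansion with integer part 0. The first two denominators
  coincide when the first partial quotient is 1, hence the hypothesis \<open>k \<ge> 1\<close> in
  strict statements.\<close>

fun cf_denom :: "real \<Rightarrow> nat \<Rightarrow> nat" where
  "cf_denom \<theta> 0 = 1"
| "cf_denom \<theta> (Suc 0) = partial_quotient \<theta> 1"
| "cf_denom \<theta> (Suc (Suc n)) = partial_quotient \<theta> (n + 2) * cf_denom \<theta> (Suc n) + cf_denom \<theta> n"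

fun cf_num :: "real \<Rightarrow> nat \<Rightarrow> nat" where
  "cf_num \<theta> 0 = 0"
| "cf_num \<theta> (Suc 0) = 1"
| "cf_num \<theta> (Suc (Suc n)) = partial_quotient \<theta> (n + 2) * cf_num \<theta> (Suc n) + cf_num \<theta> n"

lemma minus_one_square: "(-1 :: 'a :: comm_ring_1) ^ k * (-1) ^ k = 1"
  by (simp flip: power_add)

lemma mult_ge_self: "(1::int) \<le> n \<Longrightarrow> 0 < (r::real) \<Longrightarrow> r \<le> n * r"
  using mult_right_mono[of 1 "real_of_int n" r] by simp

locale unit_irrational =
  fixes \<theta> :: real
  assumes \<theta>_irrat: "\<theta> \<notin> \<rat>" and \<theta>_pos: "0 < \<theta>" and \<theta>_less_1: "\<theta> < 1"
begin

abbreviation a where "a \<equiv> partial_quotient \<theta>"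
abbreviation q where "q \<equiv> cf_denom \<theta>"
abbreviation p where "p \<equiv> cf_num \<theta>"

lemmas a_ge_1 = partial_quotient_ge_1[OF \<theta>_irrat]

lemma a_0: "a 0 = 0"
  using \<theta>_pos \<theta>_less_1 by (simp add: partial_quotient_def floor_eq_iff)

text \<open>The distance between \<open>q k * \<theta>\<close> and \<open>p k\<close>: even
  convergents lie below \<theta>, odd ones above, and the sign compensates for this.\<close>

definition \<eta> :: "nat \<Rightarrow> real" where
  "\<eta> k = (-1) ^ k * (q k * \<theta> - p k)"

lemma \<eta>_rec: "\<eta> (Suc (Suc k)) = \<eta> k - a (k + 2) * \<eta> (Suc k)"
  by (simp add: \<eta>_def algebra_simps)

lemma \<eta>_quotient: "0 < \<eta> (Suc k) \<and> \<eta> k = complete_quotient \<theta> (k + 2) * \<eta> (Suc k)"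
proof (induction k)
  case 0
  have z: "complete_quotient \<theta> 1 = 1 / \<theta>" 
    using \<theta>_pos \<theta>_less_1 complete_quotient.simps(2)[of \<theta> 0] by (simp add: frac_eq)
  have z1: "complete_quotient \<theta> 1 = a 1 + 1 / complete_quotient \<theta> 2"
    using complete_quotient_eq[OF \<theta>_irrat, of 1] by (simp add: numeral_2_eq_2)
  have z2: "complete_quotient \<theta> 2 > 1" using complete_quotient_gt_1[OF \<theta>_irrat, of 2] by simp
  have "\<eta> 1 = 1 - a 1 * \<theta>" "\<eta> 0 = \<theta>" by (simp_all add: \<eta>_def)
  moreover have "1 - a 1 * \<theta> = \<theta> / complete_quotient \<theta> 2"
    using z z1 \<theta>_pos by (simp add: field_simps)
  ultimately show ?case using z2 \<theta>_pos by (simp add: numeral_2_eq_2)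
next
  case (Suc k)
  have z: "complete_quotient \<theta> (k + 2) = a (k + 2) + 1 / complete_quotient \<theta> (k + 3)"
    using complete_quotient_eq[OF \<theta>_irrat, of "k + 2"] by (simp add: numeral_3_eq_3)
  have z1: "complete_quotient \<theta> (k + 3) > 1" using complete_quotient_gt_1[OF \<theta>_irrat, of "k + 3"] by simp
  have "\<eta> (Suc (Suc k)) = (complete_quotient \<theta> (k + 2) - a (k + 2)) * \<eta> (Suc k)"
    using Suc.IH \<eta>_rec[of k] by (simp add: algebra_simps)
  also have "\<dots> = \<eta> (Suc k) / complete_quotient \<theta> (k + 3)" using z by simp
  finally show ?case using z1 Suc.IH by (simp add: numeral_3_eq_3)
qed

lemma \<eta>_pos: "0 < \<eta> k"
  using \<eta>_quotient[of "k - 1"] \<theta>_pos by (cases k) (simp_all add: \<eta>_def)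

lemma \<eta>_decreasing: "\<eta> (Suc k) < \<eta> k"
  using \<eta>_quotient[of k] complete_quotient_gt_1[OF \<theta>_irrat, of "k + 2"] by simp

lemma \<eta>_less_1: "\<eta> k < 1"
proof (induction k)
  case 0
  then show ?case using \<theta>_less_1 by (simp add: \<eta>_def)
next
  case (Suc k)
  then show ?case using \<eta>_decreasing[of k] by linarith
qed

lemma q_pos: "0 < q k"
  by (induction k rule: induct_nat_012) (use a_ge_1[of 1] in auto)

lemma q_rec: "q (Suc (Suc k)) = a (Suc (Suc k)) * q (Suc k) + q k"
  by simp

lemma q_add_le: "q k + q (Suc k) \<le> q (Suc (Suc k))"
  using a_ge_1[of "k + 2"] by (cases "a (k + 2)") auto

lemma q_mono: "k \<ge> 1 \<Longrightarrow> q k < q (Suc k)"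
  using q_add_le[of "k - 1"] q_pos[of "k - 1"] by (cases k) (auto simp del: cf_denom.simps)

lemma q_le: "q k \<le> q (Suc k)"
  using q_mono[of k] q_pos[of 1] by (cases k) auto

lemma q_ge: "q (Suc k) \<ge> Suc k"
proof (induction k)
  case (Suc k)
  then show ?case using q_mono[of "Suc k"] by simp
qed (use q_pos[of 1] in simp)

lemma determinant: "int (q (Suc k)) * int (p k) - int (q k) * int (p (Suc k)) = - ((-1) ^ k)"
proof (induction k)
  case (Suc k)
  have "int (q (Suc (Suc k))) * int (p (Suc k)) - int (q (Suc k)) * int (p (Suc (Suc k))) =
      - (int (q (Suc k)) * int (p k) - int (q k) * int (p (Suc k)))"
    by (simp add: algebra_simps)
  then show ?case using Suc by simp
qed simp

text \<open>Consecutive pairs of denominator and numerator form a basis of the integer lattice,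
  their determinant being a unit. The two basis errors have opposite signs, so best approximation
  becomes a discussion of the signs of \<open>\<alpha>\<close> and \<open>\<beta>\<close>.\<close>

lemma convergent_coordinates:
  fixes e C :: int
  obtains \<alpha> \<beta> :: int where "e = \<alpha> * q k + \<beta> * q (Suc k)" "C = \<alpha> * p k + \<beta> * p (Suc k)"
    "(-1) ^ k * (e * \<theta> - C) = \<alpha> * \<eta> k - \<beta> * \<eta> (Suc k)"
proof -
  define s :: int where "s = (-1) ^ k"
  have ss: "s * s = 1" unfolding s_def by (rule minus_one_square)
  have det: "int (q (Suc k)) * int (p k) = int (q k) * int (p (Suc k)) - s"
    using determinant[of k] unfolding s_def by simp
  define \<alpha> where "\<alpha> = s * (e * int (p (Suc k)) - C * int (q (Suc k)))"
  define \<beta> where "\<beta> = s * (C * int (q k) - e * int (p k))"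
  have "\<alpha> * q k + \<beta> * q (Suc k) = s * e * (int (q k) * int (p (Suc k)) - int (q (Suc k)) * int (p k))"
    unfolding \<alpha>_def \<beta>_def by (simp add: algebra_simps)
  also have "\<dots> = e" using ss unfolding det by (simp add: algebra_simps)
  finally have 1: "e = \<alpha> * q k + \<beta> * q (Suc k)" by simp
  have "\<alpha> * p k + \<beta> * p (Suc k) = s * C * (int (q k) * int (p (Suc k)) - int (q (Suc k)) * int (p k))"
    unfolding \<alpha>_def \<beta>_def by (simp add: algebra_simps)
  also have "\<dots> = C" using ss unfolding det by (simp add: algebra_simps)
  finally have 2: "C = \<alpha> * p k + \<beta> * p (Suc k)" by simp
  have "(-1) ^ k * (e * \<theta> - C) = \<alpha> * \<eta> k - \<beta> * \<eta> (Suc k)"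
    unfolding arg_cong[OF 1, of real_of_int] arg_cong[OF 2, of real_of_int] \<eta>_def
    by (simp add: algebra_simps)
  with 1 2 show ?thesis by (rule that)
qed

lemma determinant_\<eta>: "q (Suc k) * \<eta> k + q k * \<eta> (Suc k) = 1"
proof -
  have "q (Suc k) * \<eta> k + q k * \<eta> (Suc k) =
      - ((-1) ^ k * real_of_int (int (q (Suc k)) * int (p k) - int (q k) * int (p (Suc k))))"
    by (simp add: \<eta>_def algebra_simps)
  also have "\<dots> = 1" unfolding determinant using minus_one_square[of k] by simp
  finally show ?thesis .
qed

lemma \<eta>_sum_less_1:
  assumes "k \<ge> 1"
  shows "\<eta> k + \<eta> (Suc k) < 1"
proof -
  have "2 \<le> q (Suc k)" using q_mono[OF assms] q_pos[of k] by simp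
  then have "2 * \<eta> k \<le> q (Suc k) * \<eta> k" using \<eta>_pos[of k]
    by (intro mult_right_mono) (auto simp del: cf_denom.simps)
  moreover have "1 * \<eta> (Suc k) \<le> q k * \<eta> (Suc k)" using \<eta>_pos[of "Suc k"] q_pos[of k]
    by (intro mult_right_mono) auto
  ultimately show ?thesis using determinant_\<eta>[of k] \<eta>_pos[of k] by linarith
qed

lemma best_approximation:
  fixes e C :: int
  assumes "0 < e" "e < q (Suc k)"
  shows "\<eta> k < (-1) ^ k * (e * \<theta> - C) \<or> e = q k \<and> C = p k
    \<or> (-1) ^ k * (e * \<theta> - C) \<le> - (\<eta> k + \<eta> (Suc k))"
proof -
  obtain \<alpha> \<beta> :: int where ab: "e = \<alpha> * q k + \<beta> * q (Suc k)" "C = \<alpha> * p k + \<beta> * p (Suc k)"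
    "(-1) ^ k * (e * \<theta> - C) = \<alpha> * \<eta> k - \<beta> * \<eta> (Suc k)"
    by (rule convergent_coordinates)
  have q: "int (q k) > 0" "int (q (Suc k)) > 0" using q_pos by simp_all
  show ?thesis
  proof (cases "\<beta> \<ge> 1")
    case True
    then have "1 * int (q (Suc k)) \<le> \<beta> * q (Suc k)" using q by (intro mult_right_mono) auto
    then have "\<alpha> * int (q k) < 0" using ab(1) assms(2) by simp
    then have "\<alpha> < 0" using q by (simp add: mult_less_0_iff)
    then have "\<eta> k \<le> (-\<alpha>) * \<eta> k" "\<eta> (Suc k) \<le> \<beta> * \<eta> (Suc k)"
      using True \<eta>_pos by (auto intro!: mult_ge_self simp del: of_int_minus)
    then show ?thesis unfolding ab(3) by simp
  next
    case False
    then have "\<beta> * int (q (Suc k)) \<le> 0" using q by (simp add: mult_le_0_iff)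
    then have "0 < \<alpha> * int (q k)" using ab(1) assms(1) by simp
    then have a1: "\<alpha> \<ge> 1" using q by (simp add: zero_less_mult_iff)
    show ?thesis
    proof (cases "\<beta> = 0")
      case True
      show ?thesis
      proof (cases "\<alpha> = 1")
        case True
        then show ?thesis using \<open>\<beta> = 0\<close> ab by simp
      next
        case False
        then have "1 * \<eta> k < \<alpha> * \<eta> k" using a1 \<eta>_pos by (intro mult_strict_right_mono) auto
        then show ?thesis unfolding ab(3) using \<open>\<beta> = 0\<close> by simp
      qed
    next
      case False
      then have "\<beta> \<le> -1" using \<open>\<not> \<beta> \<ge> 1\<close> by simp
      then have "\<eta> (Suc k) \<le> (-\<beta>) * \<eta> (Suc k)" using \<eta>_pos by (intro mult_ge_self) auto
      moreover have "\<eta> k \<le> \<alpha> * \<eta> k" using a1 \<eta>_pos by (intro mult_ge_self) auto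
      ultimately show ?thesis unfolding ab(3) using \<eta>_pos[of "Suc k"] by simp
    qed
  qed
qed

text \<open>On the side of the \<open>k\<close>-th convergent \<open>\<alpha> \<ge> 1\<close>, and
  the bound on \<open>e\<close> caps \<open>\<beta>\<close> at 0 or 1. Fixing the side is what
  extends the range of \<open>e\<close> beyond \<open>q (Suc k)\<close>.\<close>

lemma best_one_sided_approximation:
  fixes e C :: int
  assumes "0 < e" "0 < (-1) ^ k * (e * \<theta> - C)"
  shows "e < q k + q (Suc k) \<Longrightarrow> \<eta> k < (-1) ^ k * (e * \<theta> - C) \<or> e = q k \<and> C = p k"
    and "e < q k + 2 * q (Suc k) \<Longrightarrow> \<eta> k - \<eta> (Suc k) < (-1) ^ k * (e * \<theta> - C)
      \<or> e = q k + q (Suc k) \<and> C = p k + p (Suc k)"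
proof -
  obtain \<alpha> \<beta> :: int where ab: "e = \<alpha> * q k + \<beta> * q (Suc k)" "C = \<alpha> * p k + \<beta> * p (Suc k)"
    "(-1) ^ k * (e * \<theta> - C) = \<alpha> * \<eta> k - \<beta> * \<eta> (Suc k)"
    by (rule convergent_coordinates)
  have q: "int (q k) > 0" "int (q (Suc k)) > 0" using q_pos by simp_all
  have a1: "\<alpha> \<ge> 1"
  proof (rule ccontr)
    assume "\<not> \<alpha> \<ge> 1"
    then have a0: "\<alpha> \<le> 0" by simp
    then have "\<alpha> * \<eta> k \<le> 0" using \<eta>_pos[of k] by (simp add: mult_le_0_iff)
    then have "\<beta> * \<eta> (Suc k) < 0" using assms(2) ab(3) by simp
    then have "\<beta> < 0" using \<eta>_pos[of "Suc k"] by (simp add: mult_less_0_iff)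
    then have "\<beta> * q (Suc k) \<le> 0" "\<alpha> * q k \<le> 0" using a0 by (simp_all add: mult_le_0_iff)
    then show False using ab(1) assms(1) by simp
  qed
  have aq: "int (q k) \<le> \<alpha> * q k" using a1 mult_right_mono[of 1 \<alpha> "int (q k)"] by simp
  have a\<eta>: "\<eta> k \<le> \<alpha> * \<eta> k" "\<alpha> \<noteq> 1 \<Longrightarrow> \<eta> k < \<alpha> * \<eta> k"
    using a1 \<eta>_pos[of k] mult_strict_right_mono[of 1 "real_of_int \<alpha>" "\<eta> k"] by (auto intro: mult_ge_self)
  have neg: "\<eta> (Suc k) \<le> - (\<beta> * \<eta> (Suc k))" if "\<beta> < 0"
    using mult_ge_self[of "-\<beta>" "\<eta> (Suc k)"] \<eta>_pos that by simp
  show "\<eta> k < (-1) ^ k * (e * \<theta> - C) \<or> e = q k \<and> C = p k" if "e < q k + q (Suc k)"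
  proof -
    have "\<not> \<beta> \<ge> 1"
    proof
      assume "\<beta> \<ge> 1"
      then have "1 * int (q (Suc k)) \<le> \<beta> * q (Suc k)" using q by (intro mult_right_mono) auto
      then show False using that ab(1) aq by simp
    qed
    then consider "\<beta> = 0" | "\<beta> < 0" by linarith
    then show ?thesis
    proof cases
      case 1
      then show ?thesis using ab a\<eta> by (cases "\<alpha> = 1") auto
    next
      case 2
      then show ?thesis unfolding ab(3) using neg a\<eta>(1) \<eta>_pos[of "Suc k"] by simp
    qed
  qed
  show "\<eta> k - \<eta> (Suc k) < (-1) ^ k * (e * \<theta> - C) \<or> e = q k + q (Suc k) \<and> C = p k + p (Suc k)"
    if "e < q k + 2 * q (Suc k)"
  proof -
    have "\<not> \<beta> \<ge> 2"
    proof
      assume "\<beta> \<ge> 2"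
      then have "2 * int (q (Suc k)) \<le> \<beta> * q (Suc k)" using q by (intro mult_right_mono) auto
      then show False using that ab(1) aq by simp
    qed
    then consider "\<beta> = 1" | "\<beta> = 0" | "\<beta> < 0" by linarith
    then show ?thesis
    proof cases
      case 1
      then show ?thesis using ab a\<eta> by (cases "\<alpha> = 1") auto
    next
      case 2
      then show ?thesis unfolding ab(3) using a\<eta>(1) \<eta>_pos[of "Suc k"] by simp
    next
      case 3
      then show ?thesis unfolding ab(3) using neg a\<eta>(1) \<eta>_pos[of "Suc k"] by simp
    qed
  qed
qed

end

section \<open>Sturmian words as rotation words\<close>

text \<open>The quantity \<open>weight x 0 t - t \<theta> - c\<close> plays the role of the position on the circle of the
  rotation coding \<open>x\<close>. Both end points \<open>0\<close> and \<open>1\<close> are allowed, which covers the upper and the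
  lower coding at once.\<close>

locale rotation_word = unit_irrational \<theta>
  for x :: "nat \<Rightarrow> nat" and \<theta> c :: real +
  assumes position_bounds: "\<And>t. 0 \<le> weight x 0 t - t * \<theta> - c \<and> weight x 0 t - t * \<theta> - c \<le> 1"

lemma sturmian_rotation_word:
  assumes "sturmian x"
  obtains c where "rotation_word x (slope x) c"
proof -
  define E where "E t = real_of_int (weight x 0 t) - t * slope x" for t
  have diff: "E u - E t \<le> 1" for t u
  proof (cases "t \<le> u")
    case True
    then show ?thesis using sturmian_frequency(2)[OF assms, of t "u - t"] weight_add[of x 0 t "u - t"]
      unfolding E_def by (simp add: algebra_simps of_nat_diff abs_le_iff)
  next
    case False
    then show ?thesis using sturmian_frequency(2)[OF assms, of u "t - u"] weight_add[of x 0 u "t - u"]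
      unfolding E_def by (simp add: algebra_simps of_nat_diff abs_le_iff)
  qed
  \<comment> \<open>All deviations lie within distance one of each other, so their infimum can serve
    as the origin of the circle.\<close>
  define c where "c = Inf (range E)"
  have bdd: "bdd_below (range E)"
    using diff[of 0] by (intro bdd_belowI[of _ "E 0 - 1"]) (auto simp: algebra_simps)
  have "c \<le> E t" for t unfolding c_def using bdd by (intro cInf_lower) auto
  moreover have "E t - 1 \<le> c" for t unfolding c_def
    using diff[of t] by (intro cInf_greatest) (auto simp: algebra_simps)
  ultimately have pos: "0 \<le> E t - c \<and> E t - c \<le> 1" for t by (simp add: algebra_simps)
  have "slope x \<ge> 0" using sturmian_frequency(1)[OF assms]
    by (rule LIMSEQ_le_const) (auto intro!: exI[of _ 0] simp: weight_bounds[OF assms])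
  moreover have "weight x 0 n / n \<le> 1" for n
  proof -
    have "real_of_int (weight x 0 n) \<le> n" using weight_bounds(2)[OF assms, of 0 n] by linarith
    then show ?thesis by (simp add: divide_le_eq)
  qed
  then have "slope x \<le> 1" using sturmian_frequency(1)[OF assms]
    by (intro LIMSEQ_le_const2) auto
  moreover have "slope x \<noteq> 0" "slope x \<noteq> 1" using sturmian_slope_irrational[OF assms] by auto
  ultimately have "rotation_word x (slope x) c"
    using pos sturmian_slope_irrational[OF assms] by unfold_locales (auto simp: E_def)
  then show ?thesis using that by blast
qed

context rotation_word
begin

text \<open>Odd levels see the circle reflected, so that at every level the rotation by
  \<open>q k * \<theta>\<close> moves points down by \<open>\<eta> k\<close> and the interrupting
  arc lies next to 0.\<close>

definition position :: "nat \<Rightarrow> nat \<Rightarrow> real" where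
  "position k t = (if even k then weight x 0 t - t * \<theta> - c else 1 - (weight x 0 t - t * \<theta> - c))"

lemma position_01: "0 \<le> position k t" "position k t \<le> 1"
  using position_bounds[of t] by (auto simp: position_def)

lemma position_Suc: "position (Suc k) t = 1 - position k t"
  by (simp add: position_def)

lemma position_add: "position k (t + e) = position k t + (-1) ^ k * (weight x t e - e * \<theta>)"
  using weight_add[of x 0 t e] by (simp add: position_def) (simp add: algebra_simps)

lemma weight_close:
  assumes "e \<ge> 1"
  shows "\<bar>weight x t e - e * \<theta>\<bar> < 1"
proof -
  have "\<bar>weight x t e - e * \<theta>\<bar> \<le> 1"
    using position_add[of 0 t e] position_01[of 0 t] position_01[of 0 "t + e"] by simp
  moreover have "\<bar>weight x t e - e * \<theta>\<bar> \<noteq> 1"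
  proof
    assume "\<bar>weight x t e - e * \<theta>\<bar> = 1"
    then have "e * \<theta> = of_int (weight x t e - 1) \<or> e * \<theta> = of_int (weight x t e + 1)" by auto
    then obtain z :: int where "e * \<theta> = of_int z" by blast
    then have "\<theta> = of_int z / of_nat e" using assms by (simp add: field_simps)
    then have "\<theta> \<in> \<rat>" by simp
    then show False using \<theta>_irrat by simp
  qed
  ultimately show ?thesis by simp
qed

lemma sign_weight_close:
  assumes "e \<ge> 1"
  shows "\<bar>(-1) ^ k * (weight x t e - e * \<theta>)\<bar> < 1"
  using weight_close[OF assms, of t] by (simp add: abs_mult power_abs)

text \<open>\<open>hit k t = 1\<close> says that the rotation point at time \<open>t\<close> lies in the arc of length \<open>\<eta> k\<close> that the
  rotation by \<open>q k \<theta>\<close> carries across \<open>0\<close>; exactly there the period \<open>q k\<close> of \<open>x\<close> is interrupted.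
  \<open>semi_hit k\<close> is the analogue for the first intermediate fraction after the \<open>k\<close>-th convergent.\<close>

definition hit :: "nat \<Rightarrow> nat \<Rightarrow> int" where
  "hit k t = (-1) ^ k * (weight x t (q k) - int (p k))"

definition semi_hit :: "nat \<Rightarrow> nat \<Rightarrow> int" where
  "semi_hit k t = (-1) ^ k * (weight x t (q k + q (Suc k)) - int (p k) - int (p (Suc k)))"

lemma hit_real: "real_of_int (hit k t) = (-1) ^ k * (weight x t (q k) - q k * \<theta>) + \<eta> k"
  by (simp add: hit_def \<eta>_def algebra_simps)

lemma semi_hit_real: "real_of_int (semi_hit k t) =
    (-1) ^ k * (weight x t (q k + q (Suc k)) - real (q k + q (Suc k)) * \<theta>) + (\<eta> k - \<eta> (Suc k))"
  by (simp add: semi_hit_def \<eta>_def algebra_simps)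

lemma hit_01: "hit k t = 0 \<or> hit k t = 1"
proof -
  have "q k \<ge> 1" using q_pos[of k] by simp
  from sign_weight_close[OF this, of k t] have "-1 < real_of_int (hit k t)" "real_of_int (hit k t) < 2"
    using \<eta>_pos[of k] \<eta>_less_1[of k] unfolding hit_real by linarith+
  then show ?thesis by linarith
qed

lemma semi_hit_01: "semi_hit k t = 0 \<or> semi_hit k t = 1"
proof -
  have "q k + q (Suc k) \<ge> 1" using q_pos[of k] by simp
  from sign_weight_close[OF this, of k t] have "-1 < real_of_int (semi_hit k t)" "real_of_int (semi_hit k t) < 2"
    using \<eta>_pos[of "Suc k"] \<eta>_decreasing[of k] \<eta>_less_1[of k] unfolding semi_hit_real by linarith+
  then show ?thesis by linarith
qed

text \<open>A window of length \<open>q k + q (Suc k)\<close> splits in two orders, and the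
  alternating signs turn additivity into differences. As hits and semi-hits are 0 or 1, these
  identities govern the returns to the arcs.\<close>

lemma semi_hit_eq: "semi_hit k t = hit k t - hit (Suc k) (t + q k)"
  "semi_hit k t = hit k (t + q (Suc k)) - hit (Suc k) t"
proof -
  show "semi_hit k t = hit k t - hit (Suc k) (t + q k)"
    unfolding semi_hit_def hit_def weight_add by (simp add: algebra_simps)
  show "semi_hit k t = hit k (t + q (Suc k)) - hit (Suc k) t"
    unfolding semi_hit_def hit_def add.commute[of "q k" "q (Suc k)"] weight_add by (simp add: algebra_simps)
qed

lemma hit_position:
  assumes "hit k t = 1"
  shows "position k t \<le> \<eta> k"
  using position_add[of k t "q k"] hit_real[of k t] position_01[of k "t + q k"] assms by simp

lemma semi_hit_position:
  assumes "semi_hit k t = 1"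
  shows "position k t \<le> \<eta> k - \<eta> (Suc k)"
  using position_add[of k t "q k + q (Suc k)"] semi_hit_real[of k t]
    position_01[of k "t + (q k + q (Suc k))"] assms by linarith

lemma hit_disjoint:
  assumes "k \<ge> 1" "hit k t = 1"
  shows "hit (Suc k) t = 0"
proof (rule ccontr)
  assume "hit (Suc k) t \<noteq> 0"
  then have "hit (Suc k) t = 1" using hit_01 by blast
  from hit_position[OF this] hit_position[OF assms(2)] \<eta>_sum_less_1[OF assms(1)]
  show False by (simp add: position_Suc)
qed

text \<open>Two visits to an arc of length \<open>\<eta> k\<close> differ by a displacement of at
  most \<open>\<eta> k\<close>. Below \<open>q (Suc k)\<close> only a shift by \<open>q k\<close>
  with weight \<open>p k\<close> achieves this, and a hit is precisely a window of another
  weight.\<close>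

lemma hit_gap:
  assumes "k \<ge> 1" "hit k t = 1" "hit k u = 1" "t < u"
  shows "t + q (Suc k) \<le> u"
proof (rule ccontr)
  assume less: "\<not> t + q (Suc k) \<le> u"
  define e where "e = u - t"
  have e: "u = t + e" "0 < int e" "int e < q (Suc k)" using assms(4) less by (auto simp: e_def)
  have "position k u = position k t - (-1) ^ k * (int e * \<theta> - weight x t e)"
    unfolding e(1) position_add by (simp add: algebra_simps)
  then have *: "\<bar>(-1) ^ k * (int e * \<theta> - weight x t e)\<bar> \<le> \<eta> k"
    using hit_position[OF assms(2)] hit_position[OF assms(3)] position_01[of k t] position_01[of k u]
    by linarith
  from best_approximation[OF e(2,3), of "weight x t e"] *
  have "int e = q k \<and> weight x t e = p k" using \<eta>_pos[of "Suc k"] by linarith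
  then have "weight x t (q k) = p k" by auto
  then show False using assms(2) by (simp add: hit_def)
qed

lemma hit_next: "hit (Suc k) t = 1 \<Longrightarrow> hit k (t + q (Suc k)) = 1"
  using semi_hit_eq(2)[of k t] semi_hit_01[of k t] hit_01[of k "t + q (Suc k)"] by auto

lemma hit_prev: "hit (Suc k) (t + q k) = 1 \<Longrightarrow> hit k t = 1"
  using semi_hit_eq(1)[of k t] semi_hit_01[of k t] hit_01[of k t] by auto

lemma hit_branch:
  assumes "k \<ge> 1" "hit k t = 1"
  shows "hit (Suc k) (t + q k) = 1 \<longleftrightarrow> hit k (t + q (Suc k)) \<noteq> 1"
  using semi_hit_eq[of k t] hit_disjoint[OF assms] assms hit_01[of "Suc k" "t + q k"] hit_01[of k "t + q (Suc k)"]
  by auto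

lemma hit_back:
  assumes "hit k (t + q (Suc k)) = 1" "hit k t \<noteq> 1"
  shows "hit (Suc k) t = 1"
  using semi_hit_eq[of k t] hit_01[of k t] hit_01[of "Suc k" t] hit_01[of "Suc k" "t + q k"] assms by auto

text \<open>Such a shift by \<open>e\<close> moves the point down by more than
  \<open>\<eta> k\<close> unless it is the convergent itself, so a point in the arc of level
  \<open>k\<close> would be carried past 0. The period \<open>e\<close> thus breaks wherever the
  convergent on its side breaks.\<close>

lemma period_no_hit:
  assumes "0 < e" "0 < (-1) ^ k * (e * \<theta> - weight x t e)" "e < q k + q (Suc k)"
  shows "hit k t = 0"
proof (rule ccontr)
  assume "hit k t \<noteq> 0"
  then have h: "hit k t = 1" using hit_01 by blast
  have "position k (t + e) = position k t - (-1) ^ k * (int e * \<theta> - weight x t e)"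
    unfolding position_add by (simp add: algebra_simps)
  then have "(-1) ^ k * (int e * \<theta> - weight x t e) \<le> \<eta> k"
    using hit_position[OF h] position_01[of k "t + e"] by linarith
  moreover have "\<eta> k < (-1) ^ k * (int e * \<theta> - weight x t e) \<or> int e = q k \<and> weight x t e = p k"
    using assms by (intro best_one_sided_approximation(1)) auto
  ultimately have "int e = q k \<and> weight x t e = p k" by linarith
  then have "weight x t (q k) = p k" by auto
  then show False using h by (simp add: hit_def)
qed

lemma period_no_semi_hit:
  assumes "0 < e" "0 < (-1) ^ k * (e * \<theta> - weight x t e)" "e < q k + 2 * q (Suc k)"
  shows "semi_hit k t = 0"
proof (rule ccontr)
  assume "semi_hit k t \<noteq> 0"
  then have h: "semi_hit k t = 1" using semi_hit_01 by blast
  have "position k (t + e) = position k t - (-1) ^ k * (int e * \<theta> - weight x t e)"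
    unfolding position_add by (simp add: algebra_simps)
  then have "(-1) ^ k * (int e * \<theta> - weight x t e) \<le> \<eta> k - \<eta> (Suc k)"
    using semi_hit_position[OF h] position_01[of k "t + e"] by linarith
  then have "int e = q k + q (Suc k) \<and> weight x t e = p k + p (Suc k)"
    using best_one_sided_approximation(2)[of "int e" k "weight x t e"] assms by simp
  then have "weight x t (q k + q (Suc k)) = p k + p (Suc k)" by (metis of_nat_eq_iff)
  then show False using h by (simp add: semi_hit_def)
qed

end

section \<open>First interruptions of the periods\<close>

definition repetition :: "(nat \<Rightarrow> nat) \<Rightarrow> nat \<Rightarrow> nat \<Rightarrow> bool" where
  "repetition x n m \<longleftrightarrow> m \<ge> 1 \<and>
     (\<exists>i. 1 \<le> i \<and> i \<le> m - n \<and> block x i (i + n - 1) = block x (m - n + 1) m)"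

lemma rep_fun_Least: "rep_fun n x = (LEAST m. repetition x n m)"
  by (simp add: rep_fun_def repetition_def)

text \<open>Sliding a window of length \<open>e\<close> by one place exchanges
  \<open>x (s + 1)\<close> for \<open>x (s + 1 + e)\<close>. Hence \<open>n\<close> equal letters at
  distance \<open>e\<close> amount to equal weights at \<open>n + 1\<close> consecutive
  starts.\<close>

lemma repetition_iff_weight:
  assumes "n \<ge> 1"
  shows "repetition x n m \<longleftrightarrow>
    (\<exists>e t. e \<ge> 1 \<and> m = n + e + t \<and> (\<forall>s. t \<le> s \<and> s \<le> t + n \<longrightarrow> weight x s e = weight x t e))"
proof
  assume "repetition x n m"
  then obtain i where i: "1 \<le> i" "i \<le> m - n" "block x i (i + n - 1) = block x (m - n + 1) m"
    unfolding repetition_def by blast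
  define t e where "t = i - 1" and "e = m - n - t"
  have te: "e \<ge> 1" "m = n + e + t" "i = t + 1" using i(1,2) assms by (auto simp: t_def e_def)
  have "block x (t + 1) (t + 1 + n - 1) = block x (t + e + 1) (t + e + 1 + n - 1)"
    using i(3) unfolding te by (simp add: add_ac)
  then have "fac x t n = fac x (t + e) n"
    using block_eq_fac[of "t + 1" n x] block_eq_fac[of "t + e + 1" n x] assms by simp
  then have eq: "x (t + 1 + j) = x (t + e + 1 + j)" if "j < n" for j using that unfolding fac_eq_iff by blast
  have "weight x (t + j) e = weight x t e" if "j \<le> n" for j
    using that
  proof (induction j)
    case (Suc j)
    then show ?case using weight_Suc[of x "t + j" e] weight_Suc_left[of x "t + j" e] eq[of j]
      by (simp add: add_ac)
  qed simp
  then have "weight x s e = weight x t e" if "t \<le> s" "s \<le> t + n" for s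
    using that le_Suc_ex[of t s] by auto
  then show "\<exists>e t. e \<ge> 1 \<and> m = n + e + t \<and> (\<forall>s. t \<le> s \<and> s \<le> t + n \<longrightarrow> weight x s e = weight x t e)"
    using te by blast
next
  assume "\<exists>e t. e \<ge> 1 \<and> m = n + e + t \<and> (\<forall>s. t \<le> s \<and> s \<le> t + n \<longrightarrow> weight x s e = weight x t e)"
  then obtain e t where e: "e \<ge> 1" "m = n + e + t"
    and const: "\<forall>s. t \<le> s \<and> s \<le> t + n \<longrightarrow> weight x s e = weight x t e" by (elim exE conjE)
  have "fac x t n = fac x (t + e) n"
    unfolding fac_eq_iff
  proof (intro allI impI)
    fix j assume "j < n"
    then have "weight x (t + j) e = weight x t e" "weight x (Suc (t + j)) e = weight x t e"
      by (intro const[rule_format]; simp)+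
    then have "int (x (t + j + 1 + e)) = int (x (t + j + 1))"
      using weight_Suc[of x "t + j" e] weight_Suc_left[of x "t + j" e] by simp
    then show "x (t + 1 + j) = x (t + e + 1 + j)" by (simp add: add_ac)
  qed
  then have "block x (t + 1) (t + 1 + n - 1) = block x (t + e + 1) (t + e + 1 + n - 1)"
    using block_eq_fac[of "t + 1" n x] block_eq_fac[of "t + e + 1" n x] assms by simp
  then have "block x (t + 1) (t + 1 + n - 1) = block x (m - n + 1) m"
    unfolding e(2) by (simp add: add_ac)
  moreover have "1 \<le> t + 1" "t + 1 \<le> m - n" "m \<ge> 1" using e assms by simp_all
  ultimately show "repetition x n m" unfolding repetition_def by blast
qed

lemma rep_fun_le:
  assumes "n \<ge> 1" "e \<ge> 1" "\<And>s. t \<le> s \<Longrightarrow> s \<le> t + n \<Longrightarrow> weight x s e = C"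
  shows "rep_fun n x \<le> n + e + t"
proof -
  have "\<forall>s. t \<le> s \<and> s \<le> t + n \<longrightarrow> weight x s e = weight x t e" using assms(3) by simp
  then have "repetition x n (n + e + t)" unfolding repetition_iff_weight[OF assms(1)] using assms(2) by blast
  then show ?thesis unfolding rep_fun_Least by (rule Least_le)
qed

context rotation_word
begin

lemma rep_fun_le_hit:
  assumes "n \<ge> 1" "\<And>s. t \<le> s \<Longrightarrow> s \<le> t + n \<Longrightarrow> hit k s \<noteq> 1"
  shows "rep_fun n x \<le> n + q k + t"
proof (rule rep_fun_le)
  show "weight x s (q k) = p k" if "t \<le> s" "s \<le> t + n" for s
    using assms(2)[OF that] hit_01[of k s] by (auto simp: hit_def)
qed (use assms q_pos[of k] in auto)

lemma rep_fun_le_semi_hit: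
  assumes "n \<ge> 1" "\<And>s. t \<le> s \<Longrightarrow> s \<le> t + n \<Longrightarrow> semi_hit k s \<noteq> 1"
  shows "rep_fun n x \<le> n + (q k + q (Suc k)) + t"
proof (rule rep_fun_le)
  show "weight x s (q k + q (Suc k)) = p k + p (Suc k)" if "t \<le> s" "s \<le> t + n" for s
    using assms(2)[OF that] semi_hit_01[of k s] by (auto simp: semi_hit_def)
qed (use assms q_pos[of k] in auto)

definition first_hit :: "nat \<Rightarrow> nat" where
  "first_hit k = (LEAST t. hit k t = 1)"

text \<open>By \<open>hit_branch\<close>, a hit at \<open>t\<close> leads either to
  \<open>t + q (Suc k)\<close> on its own level or to \<open>t + q k\<close> on the next. Here the
  first hit takes the second way, and nothing on the next level precedes it.\<close>

definition regular :: "nat \<Rightarrow> bool" where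
  "regular k \<longleftrightarrow> first_hit k < q (Suc k) \<and> first_hit (Suc k) = first_hit k + q k"

end

text \<open>The constant \<open>33 / 20 = 1.65\<close> is slightly below \<open>r\<^sub>2\<close>; the gap absorbs every additive constant \<open>B\<close>.\<close>

locale large_rep_word = rotation_word +
  assumes large_rep_fun: "\<And>B. \<exists>N. \<forall>n\<ge>N. 33 * n + B \<le> 20 * rep_fun n x"
begin

lemma first_hit_exists: "\<exists>t. hit k t = 1"
proof (rule ccontr)
  assume no: "\<not> ?thesis"
  obtain N where N: "\<And>n. n \<ge> N \<Longrightarrow> 33 * n + 20 * q k \<le> 20 * rep_fun n x"
    using large_rep_fun[of "20 * q k"] by blast
  have "rep_fun (Suc N) x \<le> Suc N + q k + 0" using no by (intro rep_fun_le_hit) auto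
  then show False using N[of "Suc N"] by simp
qed

lemma hit_first_hit: "hit k (first_hit k) = 1"
  unfolding first_hit_def using first_hit_exists by (rule LeastI_ex)

lemma first_hit_le: "hit k t = 1 \<Longrightarrow> first_hit k \<le> t"
  unfolding first_hit_def by (rule Least_le)

text \<open>The words before the first hit and in the gap after it have period \<open>q k\<close>.
  As a repetition ends at \<open>n\<close> plus period plus start, \<open>33 - 20 = 13\<close>
  remains; 100 absorbs the offsets of the windows.\<close>

lemma first_hit_bounds: "\<exists>K. \<forall>k\<ge>K. 13 * first_hit k \<le> 20 * q k \<and> 13 * q (Suc k) \<le> 20 * (q k + first_hit k)"
proof -
  obtain N where N: "\<And>n. n \<ge> N \<Longrightarrow> 33 * n + 100 \<le> 20 * rep_fun n x"
    using large_rep_fun[of 100] by blast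
  have "13 * first_hit k \<le> 20 * q k \<and> 13 * q (Suc k) \<le> 20 * (q k + first_hit k)" if "k \<ge> N + 5" for k
  proof
    have qN: "q k \<ge> N + 5" "q (Suc k) \<ge> N + 5" using that q_ge[of k] q_ge[of "k - 1"] by (cases k; simp)+
    show "13 * first_hit k \<le> 20 * q k"
    proof (cases "first_hit k \<le> N + 1")
      case False
      have "rep_fun (first_hit k - 1) x \<le> first_hit k - 1 + q k + 0"
        using False first_hit_le[of k] by (intro rep_fun_le_hit) fastforce+
      then show ?thesis using N[of "first_hit k - 1"] False by linarith
    qed (use qN in simp)
    have "rep_fun (q (Suc k) - 2) x \<le> q (Suc k) - 2 + q k + (first_hit k + 1)"
    proof (rule rep_fun_le_hit)
      fix s assume "first_hit k + 1 \<le> s" "s \<le> first_hit k + 1 + (q (Suc k) - 2)"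
      then show "hit k s \<noteq> 1" using hit_gap[OF _ hit_first_hit[of k], of s] qN that by auto
    qed (use qN in simp)
    moreover have "33 * (q (Suc k) - 2) + 100 \<le> 20 * rep_fun (q (Suc k) - 2) x" using qN by (intro N) simp
    ultimately show "13 * q (Suc k) \<le> 20 * (q k + first_hit k)" using qN unfolding distrib_left by linarith
  qed
  then show ?thesis by blast
qed

lemma regular_step:
  assumes k: "k \<ge> 1" and less: "first_hit k < q (Suc k)"
    and upper: "13 * first_hit (Suc k) \<le> 20 * q (Suc k)" and lower: "13 * q (Suc k) \<le> 20 * (q k + first_hit k)"
  shows "regular k"
proof -
  let ?i = "first_hit k" and ?u = "first_hit (Suc k)"
  have u: "hit (Suc k) ?u = 1" and i: "hit k ?i = 1" by (rule hit_first_hit)+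
  have uq: "hit k (?u + q (Suc k)) = 1" using hit_next[OF u] .
  have prev: "hit k (?u - q k) = 1" if "q k \<le> ?u" using hit_prev[of k "?u - q k"] u that by simp
  have "hit (Suc k) (?i + q k) = 1"
  proof (rule ccontr)
    assume no: "hit (Suc k) (?i + q k) \<noteq> 1"
    then have i2: "hit k (?i + q (Suc k)) = 1" using hit_branch[OF k i] by blast
    have "?i + q k + q (Suc k) \<le> ?u"
    proof (cases "q k \<le> ?u")
      case True
      have "?u - q k \<noteq> ?i"
      proof
        assume "?u - q k = ?i"
        then have "?i + q k = ?u" using True by simp
        then show False using no u by simp
      qed
      moreover have "?i \<le> ?u - q k" using first_hit_le[OF prev[OF True]] .
      ultimately have "?i + q (Suc k) \<le> ?u - q k" using hit_gap[OF k i prev[OF True]] by simp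
      then show ?thesis using True by simp
    next
      case False
      have "?u \<noteq> ?i" using hit_disjoint[OF k i] u by auto
      then consider "?i < ?u" | "?u < ?i" by linarith
      then show ?thesis
      proof cases
        case 1
        then have "?i + q (Suc k) + q (Suc k) \<le> ?u + q (Suc k)" using hit_gap[OF k i2 uq] by simp
        then show ?thesis using False q_le[of k] by simp
      next
        case 2
        then have "?u + q (Suc k) + q (Suc k) \<le> ?i + q (Suc k)" using hit_gap[OF k uq i2] by simp
        then show ?thesis using less by simp
      qed
    qed
    \<comment> \<open>The bounds would give
      \<open>169 * q (Suc k) \<le> 260 * (?i + q k) \<le> 140 * q (Suc k)\<close>.\<close>
    then show False using upper lower q_pos[of "Suc k"] by (simp add: distrib_left)
  qed
  note iq = this
  have "?u = ?i + q k"
  proof (rule ccontr)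
    assume "?u \<noteq> ?i + q k"
    then have lt: "?u < ?i + q k" using first_hit_le[OF iq] by simp
    then have uk: "?u < q k" using first_hit_le[OF prev] by fastforce
    have iq2: "hit k (?i + q k + q (Suc k)) = 1" using hit_next[OF iq] .
    have "?u \<noteq> ?i" using hit_disjoint[OF k i] u by auto
    then consider "?i < ?u" | "?u < ?i" by linarith
    then show False
    proof cases
      case 1
      have "?u + q (Suc k) + q (Suc k) \<le> ?i + q k + q (Suc k)" using hit_gap[OF k uq iq2] lt by simp
      then show False using 1 q_le[of k] by simp
    next
      case 2
      have "?i + q (Suc k) \<le> ?u + q (Suc k)" using hit_gap[OF k i uq] less by simp
      then show False using 2 by simp
    qed
  qed
  then show ?thesis using less by (simp add: regular_def)
qed

text \<open>This starts the induction on levels where \<open>regular_step\<close> does not apply at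
  \<open>k\<close>. Stepping back by \<open>q (Suc k)\<close> from the first hit meets a hit of the
  next level; if that level began at \<open>q k\<close> or later, \<open>hit_prev\<close> would
  yield a hit of level \<open>k\<close> before the first one.\<close>

lemma regular_start:
  assumes "q (Suc k) \<le> first_hit k"
  shows "first_hit (Suc k) < q k"
proof (rule ccontr)
  let ?t = "first_hit k - q (Suc k)"
  assume "\<not> ?thesis"
  then have "hit k (first_hit (Suc k) - q k) = 1"
    using hit_prev[of k "first_hit (Suc k) - q k"] hit_first_hit[of "Suc k"] by simp
  then have 1: "first_hit k \<le> first_hit (Suc k) - q k" by (rule first_hit_le)
  have "hit k ?t \<noteq> 1" using first_hit_le[of k ?t] assms q_pos[of "Suc k"] by auto
  then have "hit (Suc k) ?t = 1" using hit_back[of k ?t] hit_first_hit[of k] assms by simp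
  then have "first_hit (Suc k) \<le> ?t" by (rule first_hit_le)
  then show False using 1 assms q_pos[of "Suc k"] by linarith
qed

lemma eventually_regular: "\<exists>K\<ge>1. \<forall>k\<ge>K. regular k"
proof -
  obtain K where K: "\<And>k. k \<ge> K \<Longrightarrow> 13 * first_hit k \<le> 20 * q k \<and> 13 * q (Suc k) \<le> 20 * (q k + first_hit k)"
    using first_hit_bounds by blast
  have step: "regular k" if "k \<ge> K + 1" "first_hit k < q (Suc k)" for k
    using regular_step[of k] K[of k] K[of "Suc k"] that by simp
  have next_less: "first_hit (Suc k) < q (Suc (Suc k))" if "regular k" for k
    using that q_add_le[of k] unfolding regular_def by linarith
  have "\<exists>k\<ge>K + 1. first_hit k < q (Suc k)"
  proof (cases "first_hit (K + 1) < q (Suc (K + 1))")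
    case False
    then have "first_hit (Suc (K + 1)) < q (K + 1)" using regular_start[of "K + 1"] by simp
    then show ?thesis using q_le[of "K + 1"] q_le[of "K + 2"] by (intro exI[of _ "K + 2"]) simp
  qed blast
  then obtain k0 where k0: "k0 \<ge> K + 1" "first_hit k0 < q (Suc k0)" by blast
  have "regular k" if "k \<ge> k0" for k
    using that
  proof (induction k rule: dec_induct)
    case base
    then show ?case using step k0 by simp
  next
    case (step n)
    then show ?case using next_less[of n] \<open>k0 \<ge> K + 1\<close> \<open>\<And>k. _ \<Longrightarrow> _ \<Longrightarrow> regular k\<close> by simp
  qed
  then show ?thesis using k0(1) by (intro exI[of _ k0]) simp
qed

lemma regular_second_hit:
  assumes "k \<ge> 1" "regular k" "hit k s = 1" "first_hit k < s"
  shows "first_hit k + q k + q (Suc k) \<le> s"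
proof (rule ccontr)
  assume less: "\<not> ?thesis"
  have iq: "hit (Suc k) (first_hit k + q k) = 1"
    using hit_first_hit[of "Suc k"] assms(2) by (simp add: regular_def)
  have "first_hit k + q (Suc k) \<le> s" using hit_gap[OF assms(1) hit_first_hit assms(3,4)] .
  moreover have "s + q (Suc k) \<le> first_hit k + q k + q (Suc k)"
    using hit_gap[OF assms(1,3) hit_next[OF iq]] less by simp
  moreover have "s \<noteq> first_hit k + q (Suc k)" using hit_branch[OF assms(1) hit_first_hit[of k]] iq assms(3) by auto
  ultimately show False using q_le[of k] by linarith
qed

lemma regular_no_semi_hit:
  assumes "k \<ge> 1" "regular k" "s < first_hit k + q k + q (Suc k)"
  shows "semi_hit k s = 0"
proof (rule ccontr)
  assume "semi_hit k s \<noteq> 0"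
  then have "semi_hit k s = 1" using semi_hit_01 by blast
  then have s: "hit k s = 1" "hit (Suc k) (s + q k) = 0"
    using semi_hit_eq(1)[of k s] hit_01[of k s] hit_01[of "Suc k" "s + q k"] by auto
  have "s \<noteq> first_hit k" using s(2) hit_first_hit[of "Suc k"] assms(2) by (auto simp: regular_def)
  then have "first_hit k < s" using first_hit_le[OF s(1)] by simp
  then show False using regular_second_hit[OF assms(1,2) s(1)] assms(3) by simp
qed

text \<open>The three inequalities are \<open>rep_fun n x \<ge> 1.65 n\<close> for the word seen before the first hit of
  level \<open>k\<close>, between its first two hits, and before the first semi-hit of level \<open>k\<close>.\<close>

definition admissible :: "nat \<Rightarrow> bool" where
  "admissible k \<longleftrightarrow> regular k \<and> 13 * first_hit k \<le> 20 * q k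
    \<and> 13 * (q k + q (Suc k)) \<le> 20 * (first_hit k + q k)
    \<and> 13 * (first_hit k + q k + q (Suc k)) \<le> 20 * (q k + q (Suc k))"

lemma eventually_admissible: "\<exists>K\<ge>1. \<forall>k\<ge>K. admissible k"
proof -
  obtain K1 where K1: "\<And>k. k \<ge> K1 \<Longrightarrow> 13 * first_hit k \<le> 20 * q k"
    using first_hit_bounds by blast
  obtain K2 where K2: "K2 \<ge> 1" "\<And>k. k \<ge> K2 \<Longrightarrow> regular k" using eventually_regular by blast
  obtain N where N: "\<And>n. n \<ge> N \<Longrightarrow> 33 * n + 100 \<le> 20 * rep_fun n x"
    using large_rep_fun[of 100] by blast
  have "admissible k" if "k \<ge> K1 + K2 + N + 5" for k
  proof -
    have qN: "q k \<ge> N + 5" "q (Suc k) \<ge> N + 5" using that q_ge[of k] q_ge[of "k - 1"] by (cases k; simp)+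
    have k: "k \<ge> 1" "regular k" using that K2 by simp_all
    let ?i = "first_hit k"
    have "rep_fun (q k + q (Suc k) - 2) x \<le> q k + q (Suc k) - 2 + q k + (?i + 1)"
    proof (rule rep_fun_le_hit)
      fix s assume "?i + 1 \<le> s" "s \<le> ?i + 1 + (q k + q (Suc k) - 2)"
      then show "hit k s \<noteq> 1" using regular_second_hit[OF k, of s] qN by auto
    qed (use qN in simp)
    moreover have "33 * (q k + q (Suc k) - 2) + 100 \<le> 20 * rep_fun (q k + q (Suc k) - 2) x"
      using qN by (intro N) simp
    ultimately have 1: "13 * (q k + q (Suc k)) \<le> 20 * (?i + q k)" using qN unfolding distrib_left by linarith
    have "rep_fun (?i + q k + q (Suc k) - 1) x \<le> ?i + q k + q (Suc k) - 1 + (q k + q (Suc k)) + 0"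
    proof (rule rep_fun_le_semi_hit)
      fix s assume "s \<le> 0 + (?i + q k + q (Suc k) - 1)"
      then show "semi_hit k s \<noteq> 1" using regular_no_semi_hit[OF k, of s] qN by auto
    qed (use qN in simp)
    moreover have "33 * (?i + q k + q (Suc k) - 1) + 100 \<le> 20 * rep_fun (?i + q k + q (Suc k) - 1) x"
      using qN by (intro N) simp
    ultimately have 2: "13 * (?i + q k + q (Suc k)) \<le> 20 * (q k + q (Suc k))" using qN unfolding distrib_left by linarith
    show ?thesis unfolding admissible_def using 1 2 k K1[of k] that by simp
  qed
  then show ?thesis using K2(1) by (intro exI[of _ "K1 + K2 + N + 5"]) simp
qed

section \<open>Forbidden blocks of partial quotients\<close>

declare cf_denom.simps(3) [simp del]

lemma admissibleD:
  assumes "admissible k"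
  shows "first_hit (Suc k) = first_hit k + q k" "13 * first_hit k \<le> 20 * q k"
    "13 * q (Suc k) \<le> 20 * first_hit k + 7 * q k" "13 * first_hit k \<le> 7 * q k + 7 * q (Suc k)"
  using assms unfolding admissible_def regular_def by simp_all

text \<open>At level \<open>Suc k\<close> the bounds \<open>admissibleD(2)\<close> and
  \<open>admissibleD(3)\<close> combine to
  \<open>169 * q (Suc (Suc k)) \<le> 491 * q (Suc k)\<close>, a ratio below 3.\<close>

lemma admissible_partial_quotient_le_2:
  assumes "admissible k" "admissible (Suc k)"
  shows "a (Suc (Suc k)) \<le> 2"
proof (rule ccontr)
  assume "\<not> ?thesis"
  then have "3 * q (Suc k) \<le> a (Suc (Suc k)) * q (Suc k)" by (intro mult_right_mono) auto
  then have "3 * q (Suc k) + q k \<le> q (Suc (Suc k))" unfolding q_rec by simp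
  then show False using admissibleD[OF assms(1)] admissibleD[OF assms(2)] q_pos[of "Suc k"] by linarith
qed

text \<open>With \<open>Q = q (Suc k)\<close> and \<open>s = first_hit (Suc k)\<close>, the bounds
  used are \<open>13 s \<le> 20 Q\<close> and \<open>31 Q + 19 q k \<le> 20 s\<close>.\<close>

lemma not_22:
  assumes adm: "\<forall>j\<ge>k. admissible j" and "a (Suc (Suc k)) = 2" "a (Suc (Suc (Suc k))) = 2"
  shows False
proof -
  note A = adm[rule_format, THEN admissibleD(1)] adm[rule_format, THEN admissibleD(2)] adm[rule_format, THEN admissibleD(3)]
  have "q (Suc (Suc k)) = 2 * q (Suc k) + q k" "q (Suc (Suc (Suc k))) = 2 * q (Suc (Suc k)) + q (Suc k)"
    using assms by (simp_all add: q_rec)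
  then show False using A(1)[of k] A(1)[of "Suc k"] A(2)[of "Suc k"] A(3)[of "Suc (Suc k)"] q_pos[of "Suc k"]
    by simp
qed

text \<open>Let \<open>i\<close>, \<open>q\<close>, \<open>Q\<close> stand for
  \<open>first_hit k\<close>, \<open>q k\<close>, \<open>q (Suc k)\<close>. The gap at level
  \<open>k + 3\<close> reads \<open>23 Q \<le> 20 i + 8 q\<close>. With the prefix bound it forces
  \<open>156 q \<le> 101 Q\<close>, with the semi-hit bound \<open>159 Q \<le> 244 q\<close>; these
  narrowly exclude each other.\<close>

lemma not_212:
  assumes adm: "\<forall>j\<ge>k. admissible j"
    and "a (Suc (Suc k)) = 2" "a (Suc (Suc (Suc k))) = 1" "a (Suc (Suc (Suc (Suc k)))) = 2"
  shows False
proof -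
  note A = adm[rule_format, THEN admissibleD(1)] adm[rule_format, THEN admissibleD(2)] adm[rule_format, THEN admissibleD(3)] adm[rule_format, THEN admissibleD(4)]
  have "q (Suc (Suc k)) = 2 * q (Suc k) + q k" "q (Suc (Suc (Suc k))) = q (Suc (Suc k)) + q (Suc k)"
    "q (Suc (Suc (Suc (Suc k)))) = 2 * q (Suc (Suc (Suc k))) + q (Suc (Suc k))"
    using assms by (simp_all add: q_rec)
  then show False
    using A(1)[of k] A(1)[of "Suc k"] A(1)[of "Suc (Suc k)"] A(4)[of k] A(2)[of "Suc k"]
      A(3)[of "Suc (Suc (Suc k))"] q_pos[of "Suc k"]
    by simp
qed

text \<open>For \<open>i\<close>, \<open>q\<close>, \<open>Q\<close> at level \<open>k\<close> as in
  \<open>not_212\<close>, the first semi-hit at level \<open>k + 4\<close> gives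
  \<open>13 i + 4 q \<le> 4 Q\<close>, and the gap at level \<open>k\<close> gives
  \<open>13 Q \<le> 20 i + 7 q\<close>.\<close>

lemma not_1111:
  assumes adm: "\<forall>j\<ge>k. admissible j"
    and "a (Suc (Suc k)) = 1" "a (Suc (Suc (Suc k))) = 1" "a (Suc (Suc (Suc (Suc k)))) = 1"
      "a (Suc (Suc (Suc (Suc (Suc k))))) = 1"
  shows False
proof -
  note A = adm[rule_format, THEN admissibleD(1)] adm[rule_format, THEN admissibleD(3)] adm[rule_format, THEN admissibleD(4)]
  have "q (Suc (Suc k)) = q (Suc k) + q k" "q (Suc (Suc (Suc k))) = q (Suc (Suc k)) + q (Suc k)"
    "q (Suc (Suc (Suc (Suc k)))) = q (Suc (Suc (Suc k))) + q (Suc (Suc k))"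
    "q (Suc (Suc (Suc (Suc (Suc k))))) = q (Suc (Suc (Suc (Suc k)))) + q (Suc (Suc (Suc k)))"
    using assms by (simp_all add: q_rec)
  then show False
    using A(1)[of k] A(1)[of "Suc k"] A(1)[of "Suc (Suc k)"] A(1)[of "Suc (Suc (Suc k))"]
      A(2)[of k] A(3)[of "Suc (Suc (Suc (Suc k)))"] q_pos[of "Suc k"]
    by simp
qed

text \<open>The two bounds of \<open>not_1111\<close>, now seven levels apart, give
  \<open>13 i + 4 q \<le> 5 Q\<close> against \<open>13 Q \<le> 20 i + 7 q\<close>. This block would
  be an exponent 1 in the final expansion.\<close>

lemma not_1112111:
  assumes adm: "\<forall>j\<ge>k. admissible j"
    and "a (Suc (Suc k)) = 1" "a (Suc (Suc (Suc k))) = 1" "a (Suc (Suc (Suc (Suc k)))) = 1"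
      "a (Suc (Suc (Suc (Suc (Suc k))))) = 2" "a (Suc (Suc (Suc (Suc (Suc (Suc k)))))) = 1"
      "a (Suc (Suc (Suc (Suc (Suc (Suc (Suc k))))))) = 1"
      "a (Suc (Suc (Suc (Suc (Suc (Suc (Suc (Suc k)))))))) = 1"
  shows False
proof -
  note A = adm[rule_format, THEN admissibleD(1)] adm[rule_format, THEN admissibleD(3)] adm[rule_format, THEN admissibleD(4)]
  have "q (Suc (Suc k)) = q (Suc k) + q k" "q (Suc (Suc (Suc k))) = q (Suc (Suc k)) + q (Suc k)"
    "q (Suc (Suc (Suc (Suc k)))) = q (Suc (Suc (Suc k))) + q (Suc (Suc k))"
    "q (Suc (Suc (Suc (Suc (Suc k))))) = 2 * q (Suc (Suc (Suc (Suc k)))) + q (Suc (Suc (Suc k)))"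
    "q (Suc (Suc (Suc (Suc (Suc (Suc k)))))) =
      q (Suc (Suc (Suc (Suc (Suc k))))) + q (Suc (Suc (Suc (Suc k))))"
    "q (Suc (Suc (Suc (Suc (Suc (Suc (Suc k))))))) =
      q (Suc (Suc (Suc (Suc (Suc (Suc k)))))) + q (Suc (Suc (Suc (Suc (Suc k)))))"
    "q (Suc (Suc (Suc (Suc (Suc (Suc (Suc (Suc k)))))))) =
      q (Suc (Suc (Suc (Suc (Suc (Suc (Suc k))))))) + q (Suc (Suc (Suc (Suc (Suc (Suc k))))))"
    using assms by (simp_all add: q_rec)
  then show False
    using A(1)[of k] A(1)[of "Suc k"] A(1)[of "Suc (Suc k)"] A(1)[of "Suc (Suc (Suc k))"]
      A(1)[of "Suc (Suc (Suc (Suc k)))"] A(1)[of "Suc (Suc (Suc (Suc (Suc k))))"]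
      A(1)[of "Suc (Suc (Suc (Suc (Suc (Suc k)))))"]
      A(2)[of k] A(3)[of "Suc (Suc (Suc (Suc (Suc (Suc (Suc k))))))"] q_pos[of "Suc k"]
    by simp
qed

definition good_index :: "nat \<Rightarrow> bool" where
  "good_index k \<longleftrightarrow> admissible k \<and> (a k = 1 \<or> a k = 2) \<and> \<not> (a k = 2 \<and> a (Suc k) = 2)
    \<and> \<not> (a k = 2 \<and> a (Suc k) = 1 \<and> a (Suc (Suc k)) = 2)
    \<and> \<not> (a k = 1 \<and> a (Suc k) = 1 \<and> a (Suc (Suc k)) = 1 \<and> a (Suc (Suc (Suc k))) = 1)
    \<and> \<not> (a k = 1 \<and> a (Suc k) = 1 \<and> a (Suc (Suc k)) = 1 \<and> a (Suc (Suc (Suc k))) = 2 \<and>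
         a (Suc (Suc (Suc (Suc k)))) = 1 \<and> a (Suc (Suc (Suc (Suc (Suc k))))) = 1 \<and> a (Suc (Suc (Suc (Suc (Suc (Suc k)))))) = 1)"

lemma eventually_good_index: "\<exists>K\<ge>1. \<forall>k\<ge>K. good_index k"
proof -
  obtain K where K: "K \<ge> 1" "\<And>k. k \<ge> K \<Longrightarrow> admissible k" using eventually_admissible by blast
  have "good_index (Suc (Suc k))" if "k \<ge> K" for k
  proof -
    have adm: "\<forall>j\<ge>k. admissible j" using K(2) that by simp
    have "a (Suc (Suc k)) \<ge> 1" "a (Suc (Suc k)) \<le> 2"
      using a_ge_1 admissible_partial_quotient_le_2[of k] adm by simp_all
    then have "a (Suc (Suc k)) = 1 \<or> a (Suc (Suc k)) = 2" by linarith
    moreover have "admissible (Suc (Suc k))" using adm by simp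
    ultimately show ?thesis
      using not_22[of k, OF adm] not_212[of k, OF adm] not_1111[of k, OF adm]
        not_1112111[of k, OF adm]
      unfolding good_index_def by fast
  qed
  then have "good_index k" if "k \<ge> K + 2" for k
    using that by (metis add_2_eq_Suc' le_Suc_ex add_Suc_right add_Suc le_add1)
  then show ?thesis using K(1) by (intro exI[of _ "K + 2"]) simp
qed

section \<open>Lower bound for the period 2, 1, 1\<close>

text \<open>Past the first hit, the window sits between consecutive hits \<open>u\<close> and
  \<open>v\<close>. Their distance is at least \<open>n + 2\<close>, since both lie strictly
  outside, and at most the longer return time.\<close>

lemma window_between_hits:
  assumes "j \<ge> 1" "\<And>s. t \<le> s \<Longrightarrow> s \<le> t + n \<Longrightarrow> hit j s = 0"
  shows "t + n < first_hit j \<or> first_hit j < t \<and> n + 2 \<le> q j + q (Suc j)"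
proof (cases "t \<le> first_hit j")
  case True
  then show ?thesis using assms(2)[of "first_hit j"] hit_first_hit[of j] by fastforce
next
  case False
  define u where "u = (GREATEST u. u < t \<and> hit j u = 1)"
  have "u < t \<and> hit j u = 1" unfolding u_def
    by (rule GreatestI_nat[of _ "first_hit j" t]) (use False hit_first_hit[of j] in auto)
  moreover have "v \<le> u" if "v < t \<and> hit j v = 1" for v unfolding u_def
    by (rule Greatest_le_nat[of _ _ t]) (use that in auto)
  ultimately have u: "u < t" "hit j u = 1" and gr: "\<And>v. v < t \<and> hit j v = 1 \<Longrightarrow> v \<le> u"
    by blast+
  have greatest: "t \<le> v" if "hit j v = 1" "u < v" for v
    by (rule ccontr) (use gr[of v] that in auto)
  have "\<exists>v>u. hit j v = 1 \<and> v \<le> u + q j + q (Suc j)"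
  proof (cases "hit j (u + q (Suc j)) = 1")
    case True
    then show ?thesis using q_pos[of "Suc j"] by (intro exI[of _ "u + q (Suc j)"]) simp
  next
    case False
    then have "hit (Suc j) (u + q j) = 1" using hit_branch[OF assms(1) u(2)] by blast
    from hit_next[OF this] show ?thesis using q_pos[of j] by (intro exI[of _ "u + q j + q (Suc j)"]) simp
  qed
  then obtain v where v: "u < v" "hit j v = 1" "v \<le> u + q j + q (Suc j)" by blast
  have "t \<le> v" using greatest v by blast
  then have "t + n < v" using assms(2)[of v] v(2) by fastforce
  then show ?thesis using u v False by linarith
qed

lemma semi_hit_of_hit:
  assumes "a (Suc (Suc j)) = 2" "hit (Suc (Suc j)) t = 1"
  shows "semi_hit j t = 1"
proof -
  have q2: "q (Suc (Suc j)) = (q j + q (Suc j)) + q (Suc j)" and p2: "p (Suc (Suc j)) = p j + 2 * p (Suc j)"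
    using assms(1) by (simp_all add: q_rec)
  have "hit (Suc (Suc j)) t = semi_hit j t - hit (Suc j) (t + (q j + q (Suc j)))"
    unfolding hit_def semi_hit_def q2 p2 weight_add[of x t "q j + q (Suc j)"]
    by (simp add: algebra_simps del: cf_num.simps)
  then show ?thesis
    using assms(2) semi_hit_01[of j t] hit_01[of "Suc j" "t + (q j + q (Suc j))"] by auto
qed

text \<open>A semi-hit returns to the arc of level \<open>j\<close> after \<open>q (Suc j)\<close>.
  If this return is no semi-hit, it branches through level \<open>Suc j\<close> and comes back at
  total time \<open>q (Suc (Suc j))\<close>; \<open>hit_gap\<close> on level \<open>Suc j\<close>
  prevents a second branching in a row.\<close>

lemma semi_hit_next:
  assumes "j \<ge> 1" "a (Suc (Suc j)) = 2" "semi_hit j s = 1"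
  shows "semi_hit j (s + q (Suc j)) = 1 \<or> semi_hit j (s + q (Suc (Suc j))) = 1"
proof -
  have q2: "q (Suc (Suc j)) = q j + 2 * q (Suc j)" using assms(2) by (simp add: q_rec)
  have s: "hit j s = 1" "hit (Suc j) (s + q j) = 0"
    using semi_hit_eq(1)[of j s] assms(3) hit_01[of j s] hit_01[of "Suc j" "s + q j"] by auto
  have s1: "hit j (s + q (Suc j)) = 1" using hit_branch[OF assms(1) s(1)] s(2) by auto
  show ?thesis
  proof (cases "hit (Suc j) (s + q (Suc j) + q j) = 1")
    case False
    then have "semi_hit j (s + q (Suc j)) = 1"
      using semi_hit_eq(1)[of j "s + q (Suc j)"] s1 hit_01[of "Suc j" "s + q (Suc j) + q j"] by auto
    then show ?thesis ..
  next
    case True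
    let ?u = "s + q (Suc (Suc j))"
    have "hit j (s + q (Suc j) + q j + q (Suc j)) = 1" using hit_next[OF True] .
    moreover have "s + q (Suc j) + q j + q (Suc j) = ?u" using q2 by simp
    ultimately have u: "hit j ?u = 1" by simp
    have "hit (Suc j) (?u + q j) \<noteq> 1"
    proof
      assume "hit (Suc j) (?u + q j) = 1"
      from hit_gap[OF _ True this] have "s + q (Suc j) + q j + q (Suc (Suc j)) \<le> ?u + q j"
        using q2 q_pos[of "Suc j"] by simp
      then show False using q2 q_pos[of "Suc j"] by simp
    qed
    then have "semi_hit j ?u = 1"
      using semi_hit_eq(1)[of j ?u] u hit_01[of "Suc j" "?u + q j"] by auto
    then show ?thesis ..
  qed
qed

lemma window_between_semi_hits:
  assumes "j \<ge> 1" "a (Suc (Suc j)) = 2" "\<And>s. t \<le> s \<Longrightarrow> s \<le> t + n \<Longrightarrow> semi_hit j s = 0"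
  shows "t + n < first_hit (Suc (Suc j)) \<or> first_hit (Suc (Suc j)) < t \<and> n \<le> q (Suc (Suc j))"
proof (cases "t \<le> first_hit (Suc (Suc j))")
  case True
  have "semi_hit j (first_hit (Suc (Suc j))) = 1" using semi_hit_of_hit[OF assms(2) hit_first_hit] .
  then show ?thesis using assms(3)[of "first_hit (Suc (Suc j))"] True by fastforce
next
  case False
  have semi: "semi_hit j (first_hit (Suc (Suc j))) = 1" using semi_hit_of_hit[OF assms(2) hit_first_hit] .
  define u where "u = (GREATEST u. u < t \<and> semi_hit j u = 1)"
  have "u < t \<and> semi_hit j u = 1" unfolding u_def
    by (rule GreatestI_nat[of _ "first_hit (Suc (Suc j))" t]) (use False semi in auto)
  moreover have "v \<le> u" if "v < t \<and> semi_hit j v = 1" for v unfolding u_def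
    by (rule Greatest_le_nat[of _ _ t]) (use that in auto)
  ultimately have u: "u < t" "semi_hit j u = 1" and gr: "\<And>v. v < t \<and> semi_hit j v = 1 \<Longrightarrow> v \<le> u"
    by blast+
  have greatest: "t \<le> v" if "semi_hit j v = 1" "u < v" for v
    by (rule ccontr) (use gr[of v] that in auto)
  obtain v where v: "semi_hit j v = 1" "u < v" "v \<le> u + q (Suc (Suc j))"
  proof -
    from semi_hit_next[OF assms(1,2) u(2)] show ?thesis
    proof
      assume "semi_hit j (u + q (Suc j)) = 1"
      then show ?thesis using that q_pos[of "Suc j"] q_le[of "Suc j"] by simp
    next
      assume "semi_hit j (u + q (Suc (Suc j))) = 1"
      then show ?thesis using that q_pos[of "Suc (Suc j)"] by simp
    qed
  qed
  have "t \<le> v" using greatest v by blast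
  then have "t + n < v" using assms(3)[of v] v(1) by fastforce
  then show ?thesis using u v False by linarith
qed

lemma repetition_exists:
  assumes "n \<ge> 1"
  shows "\<exists>m. repetition x n m"
proof -
  define k t where "k = n + 2" and "t = first_hit k + 1"
  have qk: "q (Suc k) \<ge> n + 3" using q_ge[of k] by (simp add: k_def)
  have no: "hit k s = 0" if "t \<le> s" "s \<le> t + n" for s
  proof (rule ccontr)
    assume "hit k s \<noteq> 0"
    then have "hit k s = 1" using hit_01 by blast
    from hit_gap[OF _ hit_first_hit this] have "first_hit k + q (Suc k) \<le> s"
      using that by (simp add: t_def k_def)
    then show False using that qk by (simp add: t_def)
  qed
  have "weight x s (q k) = weight x t (q k)" if "t \<le> s" "s \<le> t + n" for s
    using no[of s] no[of t] that by (auto simp: hit_def)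
  moreover have "q k \<ge> 1" using q_pos[of k] by simp
  ultimately have "repetition x n (n + q k + t)" unfolding repetition_iff_weight[OF assms] by blast
  then show ?thesis by blast
qed

lemma rep_fun_attained:
  assumes "n \<ge> 1"
  obtains e t where "e \<ge> 1" "rep_fun n x = n + e + t"
    "\<And>s. t \<le> s \<Longrightarrow> s \<le> t + n \<Longrightarrow> weight x s e = weight x t e"
proof -
  have "repetition x n (rep_fun n x)" unfolding rep_fun_Least using repetition_exists[OF assms] by (rule LeastI_ex)
  then show ?thesis unfolding repetition_iff_weight[OF assms] using that by blast
qed

lemma approximation_sign:
  fixes e :: nat
  assumes "e \<ge> 1"
  shows "0 < (-1) ^ k * (e * \<theta> - of_int C) \<or> 0 < (-1) ^ Suc k * (e * \<theta> - of_int C)"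
proof -
  have "e * \<theta> - of_int C \<noteq> 0"
  proof
    assume "e * \<theta> - of_int C = 0"
    then have "\<theta> = of_int C / of_nat e" using assms by (simp add: field_simps)
    then have "\<theta> \<in> \<rat>" by simp
    then show False using \<theta>_irrat by simp
  qed
  then show ?thesis by (cases "even k") auto
qed

lemma window_avoids:
  assumes "e \<ge> 1" "e < q (Suc k)" "\<And>s. t \<le> s \<Longrightarrow> s \<le> t + n \<Longrightarrow> weight x s e = C"
  shows "(\<forall>s. t \<le> s \<and> s \<le> t + n \<longrightarrow> hit k s = 0) \<or> (\<forall>s. t \<le> s \<and> s \<le> t + n \<longrightarrow> hit (Suc k) s = 0)"
proof -
  from approximation_sign[OF assms(1), of k C] show ?thesis
  proof
    assume "0 < (-1) ^ k * (e * \<theta> - of_int C)"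
    then show ?thesis using period_no_hit[of e k] assms by fastforce
  next
    assume "0 < (-1) ^ Suc k * (e * \<theta> - of_int C)"
    then show ?thesis using period_no_hit[of e "Suc k"] assms by fastforce
  qed
qed

text \<open>If \<open>C / e\<close> lies on the side of convergent \<open>Suc k\<close>, or on that
  of \<open>k\<close> with \<open>e\<close> small, \<open>period_no_hit\<close> applies. The
  remaining \<open>e\<close> exist only for partial quotient 2, and there the intermediate fraction
  takes over.\<close>

lemma window_level:
  assumes "e \<ge> 1" "q (Suc k) \<le> e" "e < q (Suc (Suc k))" "a (Suc (Suc k)) \<le> 2"
    "\<And>s. t \<le> s \<Longrightarrow> s \<le> t + n \<Longrightarrow> weight x s e = C"
  obtains j where "j = k \<or> j = Suc k" "q j \<le> e" "\<And>s. t \<le> s \<Longrightarrow> s \<le> t + n \<Longrightarrow> hit j s = 0"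
  | "a (Suc (Suc k)) = 2" "q k + q (Suc k) \<le> e" "\<And>s. t \<le> s \<Longrightarrow> s \<le> t + n \<Longrightarrow> semi_hit k s = 0"
proof -
  from approximation_sign[OF assms(1), of k C] consider
    "0 < (-1) ^ Suc k * (e * \<theta> - of_int C)"
    | "0 < (-1) ^ k * (e * \<theta> - of_int C)" "e < q k + q (Suc k)"
    | "0 < (-1) ^ k * (e * \<theta> - of_int C)" "q k + q (Suc k) \<le> e" by linarith
  then show ?thesis
  proof cases
    case 1
    then have "hit (Suc k) s = 0" if "t \<le> s" "s \<le> t + n" for s
      using period_no_hit[of e "Suc k" s] assms that by simp
    then show ?thesis using that(1)[of "Suc k"] assms(2) by simp
  next
    case 2
    then have "hit k s = 0" if "t \<le> s" "s \<le> t + n" for s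
      using period_no_hit[of e k s] assms that by simp
    then show ?thesis using that(1)[of k] assms(2) q_le[of k] by simp
  next
    case 3
    have "a (Suc (Suc k)) \<noteq> 1" using 3(2) assms(3) by (auto simp: q_rec)
    then have a2: "a (Suc (Suc k)) = 2" using assms(4) a_ge_1[of "Suc (Suc k)"] by simp
    then have "e < q k + 2 * q (Suc k)" using assms(3) by (simp add: q_rec)
    then have "semi_hit k s = 0" if "t \<le> s" "s \<le> t + n" for s
      using period_no_semi_hit[of e k s] 3 assms that by simp
    then show ?thesis using that(2) a2 3(2) by blast
  qed
qed

text \<open>The constant \<open>1.6504\<close> is slightly above \<open>r\<^sub>1\<close>, and well below the value \<open>\<surd>10 - 3/2\<close> of the
  exponent for an expansion that ends in the period \<open>2, 1, 1\<close>.\<close>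

definition wide_index :: "nat \<Rightarrow> bool" where
  "wide_index j \<longleftrightarrow> 6504 * first_hit j \<le> 10000 * q j
    \<and> 6504 * (q j + q (Suc j)) \<le> 10000 * (q j + first_hit j)
    \<and> (a (Suc (Suc j)) = 2 \<longrightarrow> 6504 * first_hit (Suc (Suc j)) \<le> 10000 * (q j + q (Suc j)))"

lemma rep_fun_ge_if_wide:
  assumes K: "K \<ge> 1" and wide: "\<And>j. j \<ge> K \<Longrightarrow> wide_index j \<and> regular j \<and> a j \<le> 2"
  shows "\<exists>N. \<forall>n\<ge>N. 16504 * n \<le> 10000 * rep_fun n x"
proof -
  \<comment> \<open>\<open>N\<close> exceeds every length that \<open>window_between_hits\<close>
    allows at levels \<open>K\<close> and \<open>Suc K\<close>, which excludes all periods below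
    \<open>q (Suc K)\<close>.\<close>
  define N where "N = 1 + first_hit K + first_hit (Suc K) + q K + 2 * q (Suc K) + q (Suc (Suc K))"
  have "16504 * n \<le> 10000 * rep_fun n x" if n: "n \<ge> N" for n
  proof -
    have "n \<ge> 1" using n by (simp add: N_def)
    then obtain e t where e: "e \<ge> 1" "rep_fun n x = n + e + t"
      and const: "\<And>s. t \<le> s \<Longrightarrow> s \<le> t + n \<Longrightarrow> weight x s e = weight x t e"
      using rep_fun_attained by metis
    have big: "q (Suc K) \<le> e"
    proof (rule ccontr)
      assume "\<not> ?thesis"
      then obtain j where "j = K \<or> j = Suc K" "\<And>s. t \<le> s \<Longrightarrow> s \<le> t + n \<Longrightarrow> hit j s = 0"
        using window_avoids[OF e(1) _ const] by (metis not_le)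
      moreover from this(1) have "j \<ge> 1" using K by auto
      ultimately have "t + n < first_hit j \<or> n + 2 \<le> q j + q (Suc j)" "j = K \<or> j = Suc K"
        using window_between_hits[of j t n] by blast+
      then show False using n by (auto simp: N_def)
    qed
    define k where "k = (GREATEST k. q (Suc k) \<le> e)"
    have bound: "m \<le> e" if "q (Suc m) \<le> e" for m using that q_ge[of m] by simp
    have k1: "q (Suc k) \<le> e" unfolding k_def using big bound by (rule GreatestI_nat)
    have kK: "K \<le> k" unfolding k_def using big bound by (rule Greatest_le_nat)
    have k2: "e < q (Suc (Suc k))"
    proof (rule ccontr)
      assume "\<not> ?thesis"
      then have "Suc k \<le> k" unfolding k_def by (intro Greatest_le_nat[of _ _ e]) (use bound in auto)
      then show False by simp
    qed
    have ak: "a (Suc (Suc k)) \<le> 2" using wide[of "Suc (Suc k)"] kK by simp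
    have "6504 * n \<le> 10000 * (e + t)"
    proof (rule window_level[OF e(1) k1 k2 ak const])
      fix j
      assume 1: "j = k \<or> j = Suc k" "q j \<le> e" "\<And>s. t \<le> s \<Longrightarrow> s \<le> t + n \<Longrightarrow> hit j s = 0"
      have j: "j \<ge> 1" "j \<ge> K" using 1(1) kK K by auto
      have w: "6504 * first_hit j \<le> 10000 * q j" "6504 * (q j + q (Suc j)) \<le> 10000 * (q j + first_hit j)"
        using wide[OF j(2)] unfolding wide_index_def by blast+
      from window_between_hits[of j t n, OF j(1) 1(3)] show ?thesis
        using w 1(2) unfolding distrib_left by linarith
    next
      assume 2: "a (Suc (Suc k)) = 2" "q k + q (Suc k) \<le> e"
        "\<And>s. t \<le> s \<Longrightarrow> s \<le> t + n \<Longrightarrow> semi_hit k s = 0"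
      have f: "first_hit (Suc (Suc k)) = first_hit k + q k + q (Suc k)"
        using wide[of k] wide[of "Suc k"] kK by (simp add: regular_def)
      have q2: "q (Suc (Suc k)) = q k + 2 * q (Suc k)" using 2(1) by (simp add: q_rec)
      have w: "6504 * first_hit (Suc (Suc k)) \<le> 10000 * (q k + q (Suc k))"
        using wide[OF kK] 2(1) unfolding wide_index_def by blast
      have "k \<ge> 1" using kK K by simp
      \<comment> \<open>Behind \<open>first_hit (Suc (Suc k))\<close> the start \<open>t\<close>
        together with the period exceeds \<open>q (Suc (Suc k))\<close> without help from the
        constant.\<close>
      from window_between_semi_hits[of k t n, OF this 2(1,3)] show ?thesis
        using w f q2 2(2) unfolding distrib_left by linarith
    qed
    then show ?thesis using e(2) by simp
  qed
  then show ?thesis by blast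
qed

section \<open>The three phases of the period 2, 1, 1\<close>

text \<open>\<open>first_hit\<close> grows only by adding denominators, so the slack of a bound at
  level \<open>k\<close> or \<open>Suc k\<close> stays fixed while \<open>q\<close> grows; a few
  levels later it is small enough for the sharper constant.\<close>

lemma wide_index_2112:
  assumes adm: "\<forall>j\<ge>k. admissible j"
    and "a (Suc (Suc k)) = 2" "a (Suc (Suc (Suc k))) = 1" "a (Suc (Suc (Suc (Suc k)))) = 1"
      "a (Suc (Suc (Suc (Suc (Suc k))))) = 2" "a (Suc (Suc (Suc (Suc (Suc (Suc k)))))) = 1"
  shows "wide_index (Suc (Suc (Suc (Suc k))))"
proof -
  note A = adm[rule_format, THEN admissibleD(1)] adm[rule_format, THEN admissibleD(2)]
    adm[rule_format, THEN admissibleD(3)]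
  have "q (Suc (Suc k)) = 2 * q (Suc k) + q k" "q (Suc (Suc (Suc k))) = q (Suc (Suc k)) + q (Suc k)"
    "q (Suc (Suc (Suc (Suc k)))) = q (Suc (Suc (Suc k))) + q (Suc (Suc k))"
    "q (Suc (Suc (Suc (Suc (Suc k))))) = 2 * q (Suc (Suc (Suc (Suc k)))) + q (Suc (Suc (Suc k)))"
    using assms by (simp_all add: q_rec)
  then show ?thesis unfolding wide_index_def
    using A(1)[of k] A(1)[of "Suc k"] A(1)[of "Suc (Suc k)"] A(1)[of "Suc (Suc (Suc k))"]
      A(2)[of "Suc k"] A(3)[of "Suc k"] assms(6)
    by simp
qed

lemma wide_index_1121:
  assumes adm: "\<forall>j\<ge>k. admissible j"
    and "a (Suc (Suc k)) = 1" "a (Suc (Suc (Suc k))) = 1" "a (Suc (Suc (Suc (Suc k)))) = 2"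
      "a (Suc (Suc (Suc (Suc (Suc k))))) = 1" "a (Suc (Suc (Suc (Suc (Suc (Suc k)))))) = 1"
  shows "wide_index (Suc (Suc (Suc (Suc k))))"
proof -
  note A = adm[rule_format, THEN admissibleD(1)] adm[rule_format, THEN admissibleD(2)]
  have "q (Suc (Suc k)) = q (Suc k) + q k" "q (Suc (Suc (Suc k))) = q (Suc (Suc k)) + q (Suc k)"
    "q (Suc (Suc (Suc (Suc k)))) = 2 * q (Suc (Suc (Suc k))) + q (Suc (Suc k))"
    "q (Suc (Suc (Suc (Suc (Suc k))))) = q (Suc (Suc (Suc (Suc k)))) + q (Suc (Suc (Suc k)))"
    using assms by (simp_all add: q_rec)
  then show ?thesis unfolding wide_index_def
    using A(1)[of k] A(1)[of "Suc k"] A(1)[of "Suc (Suc k)"] A(1)[of "Suc (Suc (Suc k))"]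
      A(2)[of k] assms(6)
    by simp
qed

text \<open>In this phase the partial quotient two places ahead may be 2, so here the clause on the
  intermediate fraction has content.\<close>

lemma wide_index_1211:
  assumes adm: "\<forall>j\<ge>k. admissible j"
    and "a (Suc (Suc k)) = 1" "a (Suc (Suc (Suc k))) = 2" "a (Suc (Suc (Suc (Suc k)))) = 1"
      "a (Suc (Suc (Suc (Suc (Suc k))))) = 1"
  shows "wide_index (Suc (Suc (Suc (Suc k))))"
proof -
  note A = adm[rule_format, THEN admissibleD(1)] adm[rule_format, THEN admissibleD(4)]
  have "q (Suc (Suc k)) = q (Suc k) + q k" "q (Suc (Suc (Suc k))) = 2 * q (Suc (Suc k)) + q (Suc k)"
    "q (Suc (Suc (Suc (Suc k)))) = q (Suc (Suc (Suc k))) + q (Suc (Suc k))"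
    "q (Suc (Suc (Suc (Suc (Suc k))))) = q (Suc (Suc (Suc (Suc k)))) + q (Suc (Suc (Suc k)))"
    using assms by (simp_all add: q_rec)
  then show ?thesis unfolding wide_index_def
    using A(1)[of k] A(1)[of "Suc k"] A(1)[of "Suc (Suc k)"] A(1)[of "Suc (Suc (Suc k))"]
      A(1)[of "Suc (Suc (Suc (Suc k)))"] A(1)[of "Suc (Suc (Suc (Suc (Suc k))))"]
      A(2)[of k] q_le[of k]
    by simp
qed

text \<open>Without runs of three ones, the blocks excluded by \<open>good_index\<close> leave only
  the period 2, 1, 1, so every level shows one of the three phases.\<close>

lemma rep_fun_ge_if_no_111:
  assumes K: "K \<ge> 1" and good: "\<And>k. k \<ge> K \<Longrightarrow> good_index k"
    and no: "\<And>k. k \<ge> K \<Longrightarrow> \<not> (a k = 1 \<and> a (Suc k) = 1 \<and> a (Suc (Suc k)) = 1)"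
  shows "\<exists>N. \<forall>n\<ge>N. 16504 * n \<le> 10000 * rep_fun n x"
proof (rule rep_fun_ge_if_wide)
  fix j assume j: "j \<ge> K + 4"
  obtain k where k: "j = Suc (Suc (Suc (Suc k)))" "k \<ge> K" using j
    by (intro that[of "j - 4"]) simp_all
  have adm: "\<forall>j\<ge>k. admissible j" using good k unfolding good_index_def by simp
  have g: "good_index (Suc (Suc k))" "good_index (Suc (Suc (Suc k)))" "good_index (Suc (Suc (Suc (Suc k))))"
    "good_index (Suc (Suc (Suc (Suc (Suc k)))))" "good_index (Suc (Suc (Suc (Suc (Suc (Suc k))))))"
    by (intro good; use k in simp)+
  have n: "\<not> (a (Suc (Suc k)) = 1 \<and> a (Suc (Suc (Suc k))) = 1 \<and> a (Suc (Suc (Suc (Suc k)))) = 1)"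
    "\<not> (a (Suc (Suc (Suc k))) = 1 \<and> a (Suc (Suc (Suc (Suc k)))) = 1 \<and> a (Suc (Suc (Suc (Suc (Suc k))))) = 1)"
    by (intro no; use k in simp)+
  have "wide_index j" unfolding k(1)
    using wide_index_2112[OF adm] wide_index_1121[OF adm] wide_index_1211[OF adm] g n
    unfolding good_index_def by metis
  moreover have "regular j" "a j \<le> 2" using good[of j] j unfolding good_index_def admissible_def by auto
  ultimately show "wide_index j \<and> regular j \<and> a j \<le> 2" by blast
qed (use K in simp)

end

section \<open>The continued fraction expansion\<close>

text \<open>The value \<open>[c 0, ..., c (n - 1), y]\<close> with a real last entry. It can also be
  unfolded from the end, as the recurrences of numerators and denominators require.\<close>

fun cf_value :: "int stream \<Rightarrow> nat \<Rightarrow> real \<Rightarrow> real" where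
  "cf_value c 0 y = y"
| "cf_value c (Suc n) y = of_int (shd c) + 1 / cf_value (stl c) n y"

lemma convergent_cf_eq_cf_value: "convergent_cf c n = cf_value c n (of_int (c !! n))"
  by (induction n arbitrary: c) simp_all

lemma cf_value_Suc: "cf_value c (Suc n) y = cf_value c n (of_int (c !! n) + 1 / y)"
  by (induction n arbitrary: c) simp_all

text \<open>A stream is read off from a state \<open>m\<close> in blocks \<open>b m\<close>, with
  next state \<open>g m\<close>. Nonempty blocks make the remaining index smaller, so strong
  induction on the position applies.\<close>

lemma flat_siterate:
  assumes "\<And>m. P m \<Longrightarrow> f m = b m @- f (g m) \<and> P (g m) \<and> b m \<noteq> []" "P m"
  shows "f m = flat (smap b (siterate g m))"
proof -
  have "f m !! i = flat (smap b (siterate g m)) !! i" for i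
    using assms(2)
  proof (induction i arbitrary: m rule: less_induct)
    case (less i)
    note m = assms(1)[OF less.prems]
    have unfold: "flat (smap b (siterate g m)) = b m @- flat (smap b (siterate g (g m)))"
      using m by (subst siterate.code) simp
    show ?case
    proof (cases "i < length (b m)")
      case True
      then show ?thesis using m unfold by (simp add: shift_snth_less)
    next
      case False
      then have "i - length (b m) < i" using m by (cases "b m") auto
      then have "f (g m) !! (i - length (b m)) = flat (smap b (siterate g (g m))) !! (i - length (b m))"
        using less.IH m by blast
      then show ?thesis using m unfold False by (simp add: shift_snth_ge)
    qed
  qed
  then have "(!!) (f m) = (!!) (flat (smap b (siterate g m)))" by (rule ext)
  then show ?thesis using stream_smap_nats[of "f m"] stream_smap_nats[of "flat (smap b (siterate g m))"]
    by metis
qed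

context unit_irrational
begin

definition quotients_from :: "nat \<Rightarrow> int stream" where
  "quotients_from k = smap (\<lambda>i. int (a i)) (fromN k)"

lemma quotients_from_Cons: "quotients_from k = int (a k) ## quotients_from (Suc k)"
  by (simp add: quotients_from_def) (subst siterate.code, simp)

lemma snth_quotients_from: "quotients_from k !! i = int (a (k + i))"
  by (simp add: quotients_from_def add.commute)

lemma cf_value_quotients:
  fixes y :: real
  assumes "y > 0"
  shows "cf_value (quotients_from 0) (Suc (Suc n)) y = (p (Suc n) * y + p n) / (q (Suc n) * y + q n)"
  using assms
proof (induction n arbitrary: y)
  case 0
  have "real (a 1) + 1 / y > 0" using 0 by (simp add: add_nonneg_pos)
  moreover have "cf_value (quotients_from 0) (Suc (Suc 0)) y = 1 / (real (a 1) + 1 / y)"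
    by (simp add: quotients_from_Cons[of 0] quotients_from_Cons[of "Suc 0"] a_0)
  ultimately show ?case using 0 by (simp add: field_simps)
next
  case (Suc n)
  let ?y = "real (a (Suc (Suc n))) + 1 / y"
  have y: "?y > 0" using Suc.prems by (simp add: add_nonneg_pos)
  have "cf_value (quotients_from 0) (Suc (Suc (Suc n))) y = cf_value (quotients_from 0) (Suc (Suc n)) ?y"
    unfolding cf_value_Suc[of _ "Suc (Suc n)"] snth_quotients_from by simp
  also have "\<dots> = (p (Suc n) * ?y + p n) / (q (Suc n) * ?y + q n)" using Suc.IH[OF y] .
  also have "\<dots> = ((p (Suc n) * ?y + p n) * y) / ((q (Suc n) * ?y + q n) * y)" using Suc.prems by simp
  also have "(p (Suc n) * ?y + p n) * y = p (Suc (Suc n)) * y + p (Suc n)"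
    using Suc.prems by (simp add: field_simps)
  also have "(q (Suc n) * ?y + q n) * y = q (Suc (Suc n)) * y + q (Suc n)"
    using Suc.prems by (simp add: field_simps)
  finally show ?case .
qed

lemma convergent_cf_quotients: "convergent_cf (quotients_from 0) (Suc (Suc n)) = p (Suc (Suc n)) / q (Suc (Suc n))"
proof -
  have "a (Suc (Suc n)) \<ge> 1" using a_ge_1 by simp
  then show ?thesis unfolding convergent_cf_eq_cf_value snth_quotients_from
    by (subst cf_value_quotients) (auto simp: mult.commute)
qed

lemma has_cf_expansion_quotients: "has_cf_expansion \<theta> (quotients_from 0)"
  unfolding has_cf_expansion_def
proof (intro conjI allI impI)
  fix i :: nat assume "i \<ge> 1"
  then show "quotients_from 0 !! i > 0" using a_ge_1[of i] by (simp add: snth_quotients_from)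
next
  have "norm (p (Suc (Suc n)) / q (Suc (Suc n)) - \<theta>) \<le> inverse (real (Suc n))" for n
  proof -
    let ?k = "Suc (Suc n)"
    have q: "real (q ?k) \<ge> real (Suc n)" using q_ge[of "Suc n"] by linarith
    have "\<bar>q ?k * \<theta> - p ?k\<bar> = \<eta> ?k"
    proof -
      have "\<bar>\<eta> ?k\<bar> = \<bar>q ?k * \<theta> - p ?k\<bar>"
        unfolding \<eta>_def by (simp only: abs_mult power_abs abs_minus_cancel abs_one power_one mult_1)
      then show ?thesis using \<eta>_pos[of ?k] by simp
    qed
    then have "\<bar>q ?k * \<theta> - p ?k\<bar> \<le> 1" using \<eta>_less_1[of ?k] by simp
    then have "\<bar>q ?k * \<theta> - p ?k\<bar> / q ?k \<le> 1 / q ?k" by (intro divide_right_mono) auto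
    also have "\<dots> \<le> inverse (real (Suc n))" using q by (simp add: field_simps del: cf_denom.simps)
    also have "\<bar>q ?k * \<theta> - p ?k\<bar> / q ?k = \<bar>(q ?k * \<theta> - p ?k) / q ?k\<bar>" by (simp add: abs_divide)
    also have "(q ?k * \<theta> - p ?k) / q ?k = \<theta> - p ?k / q ?k"
      using q_pos[of ?k] by (simp add: field_simps del: cf_denom.simps cf_num.simps)
    finally show ?thesis by (simp add: abs_minus_commute del: cf_denom.simps cf_num.simps)
  qed
  then have "(\<lambda>n. p (Suc (Suc n)) / q (Suc (Suc n)) - \<theta>) \<longlonglongrightarrow> 0"
    by (intro tendsto_0_le[OF LIMSEQ_inverse_real_of_nat, where K = 1] always_eventually)
      (simp del: cf_denom.simps cf_num.simps)
  then have "(\<lambda>n. convergent_cf (quotients_from 0) (Suc (Suc n))) \<longlonglongrightarrow> \<theta>"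
    unfolding convergent_cf_quotients by (rule LIM_zero_cancel)
  then show "convergent_cf (quotients_from 0) \<longlonglongrightarrow> \<theta>"
    by (simp only: filterlim_sequentially_Suc[of "\<lambda>n. convergent_cf (quotients_from 0) (Suc n)"]
        filterlim_sequentially_Suc)
qed

lemma quotients_from_blocks:
  assumes "\<And>i. i < n \<Longrightarrow> a (k + 3 * i) = 2 \<and> a (Suc (k + 3 * i)) = 1 \<and> a (Suc (Suc (k + 3 * i))) = 1"
  shows "quotients_from k = concat (replicate n [2, 1, 1]) @- quotients_from (k + 3 * n)"
  using assms
proof (induction n arbitrary: k)
  case (Suc n)
  have "quotients_from (k + 3) = concat (replicate n [2, 1, 1]) @- quotients_from (k + 3 + 3 * n)"
  proof (rule Suc.IH)
    fix i assume "i < n"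
    then show "a (k + 3 + 3 * i) = 2 \<and> a (Suc (k + 3 + 3 * i)) = 1 \<and> a (Suc (Suc (k + 3 + 3 * i))) = 1"
      using Suc.prems[of "Suc i"] by (simp add: add_ac)
  qed
  moreover have "quotients_from k = 2 ## 1 ## 1 ## quotients_from (k + 3)"
    using Suc.prems[of 0] quotients_from_Cons[of k] quotients_from_Cons[of "Suc k"]
      quotients_from_Cons[of "Suc (Suc k)"] by (simp add: eval_nat_numeral)
  ultimately show ?case by (simp add: add_ac)
qed simp

end

context large_rep_word
begin

text \<open>Such a run marks the end of a block: the last two ones of the repeated 2, 1, 1 and the
  separate 1.\<close>

definition triple_one :: "nat \<Rightarrow> bool" where
  "triple_one m \<longleftrightarrow> a m = 1 \<and> a (Suc m) = 1 \<and> a (Suc (Suc m)) = 1"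

text \<open>A run is followed by 2 since four ones are excluded, and after 1, 1 by another 2 since
  1112111 is; hence the exponent exceeds 1. The 2s recur with spacing 3 until a later run breaks the
  pattern, and the first break is a 1 that completes the next run.\<close>

lemma next_triple_one:
  assumes good: "\<And>k. k \<ge> K \<Longrightarrow> good_index k" and inf: "\<And>k. \<exists>m\<ge>k. triple_one m"
    and m: "m \<ge> K" "triple_one m"
  shows "\<exists>n>1. triple_one (m + 3 * n + 1) \<and>
    quotients_from (m + 3) = cf_block n @- quotients_from (m + 3 * n + 1 + 3)"
proof -
  let ?b = "m + 3"
  have 12: "a k = 1 \<or> a k = 2" if "k \<ge> K" for k using good[OF that] unfolding good_index_def by blast
  have after2: "a (Suc k) = 1 \<and> a (Suc (Suc k)) = 1" if "k \<ge> K" "a k = 2" for k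
    using good[OF that(1)] that 12[of "Suc k"] 12[of "Suc (Suc k)"] unfolding good_index_def by auto
  have b0: "a ?b = 2"
    using good[OF m(1)] m 12[of ?b] unfolding good_index_def triple_one_def by (auto simp: eval_nat_numeral)
  have b1: "a (?b + 3) = 2"
    using good[OF m(1)] m 12[of "?b + 3"] after2[of ?b] b0
    unfolding good_index_def triple_one_def by (auto simp: eval_nat_numeral)
  have "\<exists>n. a (?b + 3 * n) \<noteq> 2"
  proof (rule ccontr)
    assume "\<not> ?thesis"
    then have all2: "a (?b + 3 * n) = 2" for n by blast
    obtain k where k: "k \<ge> ?b" "triple_one k" using inf by blast
    define i where "i = k - ?b"
    have ki: "k = ?b + i" using k by (simp add: i_def)
    have "i = 3 * (i div 3) + i mod 3" "i mod 3 < 3" by simp_all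
    \<comment> \<open>Three consecutive indices meet every residue class modulo 3, so the run would
      contain one of the 2s.\<close>
    then consider "i = 3 * (i div 3)" | "i + 1 = 3 * (i div 3 + 1)" | "i + 2 = 3 * (i div 3 + 1)"
      unfolding distrib_left by linarith
    then have "a k = 2 \<or> a (Suc k) = 2 \<or> a (Suc (Suc k)) = 2"
    proof cases
      case 1
      then show ?thesis using all2[of "i div 3"] ki by simp
    next
      case 2
      then show ?thesis using all2[of "i div 3 + 1"] ki by (metis add.assoc Suc_eq_plus1)
    next
      case 3
      then show ?thesis using all2[of "i div 3 + 1"] ki by (metis add.assoc add_2_eq_Suc')
    qed
    then show False using k(2) unfolding triple_one_def by auto
  qed
  define n where "n = (LEAST n. a (?b + 3 * n) \<noteq> 2)"
  have n: "a (?b + 3 * n) \<noteq> 2" unfolding n_def using \<open>\<exists>n. a (?b + 3 * n) \<noteq> 2\<close> by (rule LeastI_ex)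
  have less: "a (?b + 3 * i) = 2" if "i < n" for i using not_less_Least[OF that[unfolded n_def]] by blast
  have "n \<noteq> 0" using n b0 by (metis add_0_right mult_0_right)
  moreover have "n \<noteq> 1" using n b1 by (metis mult_1_right)
  ultimately have n1: "n > 1" by simp
  have an: "a (?b + 3 * n) = 1" using n 12[of "?b + 3 * n"] m(1) by simp
  have blocks: "a (?b + 3 * i) = 2 \<and> a (Suc (?b + 3 * i)) = 1 \<and> a (Suc (Suc (?b + 3 * i))) = 1" if "i < n" for i
    using less[OF that] after2[of "?b + 3 * i"] m(1) by simp
  have "Suc (?b + 3 * (n - 1)) = m + 3 * n + 1" using n1 by simp
  then have "triple_one (m + 3 * n + 1)"
    using blocks[of "n - 1"] n1 an unfolding triple_one_def by (simp add: add_ac eval_nat_numeral)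
  moreover have "quotients_from ?b = cf_block n @- quotients_from (m + 3 * n + 1 + 3)"
  proof -
    have "quotients_from ?b = concat (replicate n [2, 1, 1]) @- quotients_from (?b + 3 * n)"
      by (rule quotients_from_blocks) (rule blocks)
    also have "quotients_from (?b + 3 * n) = 1 ## quotients_from (m + 3 * n + 1 + 3)"
      using quotients_from_Cons[of "?b + 3 * n"] an by (simp add: add_ac)
    finally show ?thesis by (simp add: cf_block_def)
  qed
  ultimately show ?thesis using n1 by blast
qed

lemma cf_blocks:
  assumes good: "\<And>k. k \<ge> K \<Longrightarrow> good_index k" and inf: "\<And>k. \<exists>m\<ge>k. triple_one m"
  obtains as ns where "\<forall>n\<in>sset ns. n > 1" "has_cf_expansion \<theta> ((0 # as) @- flat (smap cf_block ns))"
proof -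
  obtain N where N: "\<And>m. m \<ge> K \<and> triple_one m \<Longrightarrow> N m > 1 \<and> triple_one (m + 3 * N m + 1) \<and>
    quotients_from (m + 3) = cf_block (N m) @- quotients_from (m + 3 * N m + 1 + 3)"
    using next_triple_one[of K, OF good inf] by metis
  obtain m where m: "m \<ge> K" "triple_one m" using inf by blast
  define g where "g m = m + 3 * N m + 1" for m
  define ns where "ns = smap N (siterate g m)"
  have "quotients_from (m + 3) = flat (smap (\<lambda>m. cf_block (N m)) (siterate g m))"
  proof (rule flat_siterate[where P = "\<lambda>m. m \<ge> K \<and> triple_one m" and f = "\<lambda>m. quotients_from (m + 3)"])
    fix m assume "m \<ge> K \<and> triple_one m"
    from N[OF this] this show "quotients_from (m + 3) = cf_block (N m) @- quotients_from (g m + 3) \<and>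
      (K \<le> g m \<and> triple_one (g m)) \<and> cf_block (N m) \<noteq> []"
      by (simp add: g_def cf_block_def)
  qed (use m in simp)
  then have flat: "quotients_from (m + 3) = flat (smap cf_block ns)"
    by (simp add: ns_def stream.map_comp comp_def)
  have "(g ^^ i) m \<ge> K \<and> triple_one ((g ^^ i) m)" for i
  proof (induction i)
    case (Suc i)
    from N[OF this] this show ?case by (simp add: g_def)
  qed (use m in simp)
  then have ns: "\<forall>n\<in>sset ns. n > 1"
    using N by (auto simp: ns_def sset_range)
  \<comment> \<open>The free initial part stops at index \<open>m + 2\<close>, the last one of a
    first run.\<close>
  have "sdrop (m + 2) (quotients_from 1) = quotients_from (m + 3)"
    by (simp add: quotients_from_def sdrop_smap eval_nat_numeral)
  then have "quotients_from 0 = (0 # stake (m + 2) (quotients_from 1)) @- quotients_from (m + 3)"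
    using quotients_from_Cons[of 0] a_0 stake_sdrop[of "m + 2" "quotients_from 1"] by simp
  then have "has_cf_expansion \<theta> ((0 # stake (m + 2) (quotients_from 1)) @- flat (smap cf_block ns))"
    using has_cf_expansion_quotients flat by simp
  then show ?thesis using that ns by blast
qed

end

theorem theorem0p5:
  fixes x :: "nat \<Rightarrow> nat"
  assumes "sturmian x"
    and "ereal ((415 * sqrt 149 - 2693) / 1438) \<le> rep x"
    and "rep x \<le> ereal ((48 + sqrt 10) / 31)"
  shows "\<exists>(as :: int list) (ns :: nat stream).
           (\<forall>n \<in> sset ns. n > 1) \<and>
           has_cf_expansion (slope x) ((0 # as) @- flat (smap cf_block ns))"
proof -
  obtain c where "rotation_word x (slope x) c" using sturmian_rotation_word[OF assms(1)] .
  then interpret rotation_word x "slope x" c .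
  have "12.20654 < sqrt 149" by (rule real_less_rsqrt) (simp add: power2_eq_square)
  \<comment> \<open>The value 1.650005 lies between \<open>33 / 20\<close> and
    \<open>r\<^sub>2\<close>. Twenty times its excess over \<open>33 / 20\<close> is 1/10000, hence
    \<open>10000 * B\<close> below.\<close>
  then have "ereal 330001 / 200000 < ereal ((415 * sqrt 149 - 2693) / 1438)" by simp
  also note assms(2)
  finally have "\<forall>\<^sub>F n in sequentially. ereal 330001 / 200000 < ereal (real (rep_fun n x) / real n)"
    unfolding rep_def by (rule less_LiminfD)
  then obtain N where N: "\<And>n. n \<ge> N \<Longrightarrow> 330001 / 200000 < real (rep_fun n x) / real n"
    unfolding eventually_sequentially by auto
  interpret large_rep_word x "slope x" c
  proof
    fix B
    have "33 * n + B \<le> 20 * rep_fun n x" if "n \<ge> N + 10000 * B + 1" for n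
    proof -
      have "330001 / 200000 * real n < rep_fun n x" 
        using N[of n] that by (simp add: pos_less_divide_eq)
      moreover have "real n \<ge> 10000 * real B" using that by linarith
      ultimately have "33 * real n + real B \<le> 20 * real (rep_fun n x)" by linarith
      then show ?thesis by linarith
    qed
    then show "\<exists>N. \<forall>n\<ge>N. 33 * n + B \<le> 20 * rep_fun n x" by blast
  qed
  obtain K where K: "K \<ge> 1" "\<And>k. k \<ge> K \<Longrightarrow> good_index k" using eventually_good_index by blast
  have inf: "\<exists>m\<ge>k. triple_one m" for k
  proof (rule ccontr)
    assume no: "\<not> ?thesis"
    have "\<exists>N. \<forall>n\<ge>N. 16504 * n \<le> 10000 * rep_fun n x"
    proof (rule rep_fun_ge_if_no_111[of "max K k"])
      show "\<not> (a j = 1 \<and> a (Suc j) = 1 \<and> a (Suc (Suc j)) = 1)" if "j \<ge> max K k" for j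
        using no that unfolding triple_one_def by auto
    qed (use K in auto)
    then obtain N where N: "\<And>n. n \<ge> N \<Longrightarrow> 16504 * n \<le> 10000 * rep_fun n x" by blast
    have "ereal 1.6504 \<le> ereal (real (rep_fun n x) / real n)" if "n \<ge> N + 1" for n
    proof -
      have "16504 * real n \<le> 10000 * real (rep_fun n x)" using N[of n] that by linarith
      then show ?thesis using that by (simp add: field_simps)
    qed
    then have "ereal 1.6504 \<le> rep x" unfolding rep_def
      by (intro Liminf_bounded) (auto simp: eventually_sequentially)
    also note assms(3)
    finally have "1.6504 \<le> (48 + sqrt 10) / 31" by simp
    \<comment> \<open>The threshold to stay below is
      \<open>1.6504 * 31 - 48 = 3.1624\<close>.\<close>
    moreover have "sqrt 10 < 3.16228" by (rule real_less_lsqrt) (simp_all add: power2_eq_square)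
    ultimately show False by simp
  qed
  show ?thesis using cf_blocks[of K, OF K(2) inf] by metis
qed

end
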